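(* Let $(\Omega,\Sigma,\mu)$ be a measure space, $X(\mu)$ an ideal function space with the $\sigma$-property, $E$ a Banach space and $T\colon X(\mu)\to E$ an order-w continuous linear operator. Then $[i]\colon X(\mu)\to L^1(m_T)$ is well defined, $T=I_{m_T}\circ[i]$, and $I_{m_T}\colon L^1(m_T)\to E$ is order-w continuous. Moreover, this factorization is optimal: if $\xi$ is a measure on $\Sigma$ with $\xi\ll\mu$, $Z(\xi)$ is an ideal function space such that $[i]\colon X(\mu)\to Z(\xi)$ is well defined, and $S\colon Z(\xi)\to E$ is an order-w continuous linear operator with $T=S\circ[i]$, then $[i]\colon Z(\xi)\to L^1(m_T)$ is well defined and $S=I_{m_T}\circ[i]$.
   Context: $L^0(\lambda)$: $\lambda$-a.e. classes of $\Sigma$-measurable real functions. Ideal function space (i.f.s.) $Y(\lambda)$: a vector subspace of $L^0(\lambda)$ with $f\in Y(\lambda)$, $g\in L^0(\lambda)$, $|g|\le|f|$ a.e. $\Rightarrow g\in Y(\lambda)$. $\sigma$-property: $\Omega=\bigcup_n\Omega_n$ with $\Omega_n\in\Sigma$, $\chi_{\Omega_n}\in X(\mu)$. For set functions $\lambda,\xi$ on $\Sigma$, $\xi\ll\lambda$ means $\lambda(A)=0\Rightarrow\xi(A)=0$; then $[i]$ sends the $\lambda$-class of $f$ to its $\xi$-class, and "$[i]\colon Y(\lambda)\to Z(\xi)$ is well defined" means $\xi\ll\lambda$ and the $\xi$-class of every $f\in Y(\lambda)$ lies in $Z(\xi)$. An operator $T$ on an i.f.s. is order-w continuous if $T(f_n)\to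 T(f)$ weakly whenever $0\le f_n\uparrow f$ a.e. with $f_n,f$ in the space. $\Sigma_{X(\mu)}=\{A\in\Sigma:\chi_A\in X(\mu)\}$ is a $\delta$-ring with local $\sigma$-algebra $\Sigma$, and $m_T\colon\Sigma_{X(\mu)}\to E$, $m_T(A)=T(\chi_A)$; for order-w continuous $T$ this is a countably additive vector measure. For a vector measure $m$ on $\Sigma_{X(\mu)}$: $|x^*m|$ is the variation of $x^*\circ m$ on $\Sigma$, $\|m\|(A)=\sup_{x^*\in B_{E^*}}|x^*m|(A)$, $L^0(m)$ is the space of $\Sigma$-measurable functions modulo $\|m\|$-null sets, and $L^1(m)$ consists of $f\in L^0(m)$ with $f\in L^1(|x^*m|)$ for all $x^*\in E^*$ such that for each $A\in\Sigma$ there is $\int_Af\,dm\in E$ with $x^*(\int_Af\,dm)=\int_Af\,dx^*m$ for all $x^*$; it is an i.f.s. (over any measure on $\Sigma$ with the same null sets as $\|m\|$) with norm $\sup_{x^*\in B_{E^*}}\int|f|\,d|x^*m|$; $I_m(f)=\int_\Omega f\,dm$. *)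

theory Defs
  imports "HOL-Analysis.Analysis"
begin

text \<open>Functions on the measurable space of M (Omega, Sigma) are represented by
representatives; a set function on Sigma is represented through its family N of
null sets. All spaces/operators are required to be compatible with N-a.e. equality.\<close>

definition ae_wrt :: "'a measure \<Rightarrow> 'a set set \<Rightarrow> ('a \<Rightarrow> bool) \<Rightarrow> bool" where
  "ae_wrt M N P \<longleftrightarrow> (\<exists>A\<in>N. {x\<in>space M. \<not> P x} \<subseteq> A)"

definition ideal_fs :: "'a measure \<Rightarrow> 'a set set \<Rightarrow> ('a \<Rightarrow> real) set \<Rightarrow> bool" where
  "ideal_fs M N Y \<longleftrightarrow> Y \<subseteq> borel_measurable M \<and> (\<lambda>x. 0) \<in> Y
     \<and> (\<forall>f\<in>Y. \<forall>g\<in>Y. (\<lambda>x. f x + g x) \<in> Y)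
     \<and> (\<forall>c. \<forall>f\<in>Y. (\<lambda>x. c * f x) \<in> Y)
     \<and> (\<forall>f\<in>Y. \<forall>g\<in>borel_measurable M. ae_wrt M N (\<lambda>x. \<bar>g x\<bar> \<le> \<bar>f x\<bar>) \<longrightarrow> g \<in> Y)"

definition sigma_property :: "'a measure \<Rightarrow> ('a \<Rightarrow> real) set \<Rightarrow> bool" where
  "sigma_property M X \<longleftrightarrow> (\<exists>\<Omega>s :: nat \<Rightarrow> 'a set.
     (\<forall>n. \<Omega>s n \<in> sets M \<and> (indicator (\<Omega>s n) :: 'a \<Rightarrow> real) \<in> X) \<and> (\<Union>n. \<Omega>s n) = space M)"

definition class_op :: "'a measure \<Rightarrow> 'a set set \<Rightarrow> ('a \<Rightarrow> real) set \<Rightarrow> (('a \<Rightarrow> real) \<Rightarrow> 'e) \<Rightarrow> bool" where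
  "class_op M N Y T \<longleftrightarrow> (\<forall>f\<in>Y. \<forall>g\<in>Y. ae_wrt M N (\<lambda>x. f x = g x) \<longrightarrow> T f = T g)"

definition linear_op :: "'a measure \<Rightarrow> 'a set set \<Rightarrow> ('a \<Rightarrow> real) set \<Rightarrow> (('a \<Rightarrow> real) \<Rightarrow> 'e::real_vector) \<Rightarrow> bool" where
  "linear_op M N Y T \<longleftrightarrow> class_op M N Y T
     \<and> (\<forall>f\<in>Y. \<forall>g\<in>Y. T (\<lambda>x. f x + g x) = T f + T g)
     \<and> (\<forall>c. \<forall>f\<in>Y. T (\<lambda>x. c * f x) = c *\<^sub>R T f)"

definition order_w_cont :: "'a measure \<Rightarrow> 'a set set \<Rightarrow> ('a \<Rightarrow> real) set \<Rightarrow> (('a \<Rightarrow> real) \<Rightarrow> 'e::real_normed_vector) \<Rightarrow> bool" where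
  "order_w_cont M N Y T \<longleftrightarrow> (\<forall>fs f. (\<forall>n. fs n \<in> Y) \<and> f \<in> Y \<and>
       ae_wrt M N (\<lambda>x. \<forall>n. 0 \<le> fs n x \<and> fs n x \<le> fs (Suc n) x \<and> (\<lambda>n. fs n x) \<longlonglongrightarrow> f x)
     \<longrightarrow> (\<forall>xs :: 'e \<Rightarrow> real. bounded_linear xs \<longrightarrow> (\<lambda>n. xs (T (fs n))) \<longlonglongrightarrow> xs (T f)))"

text \<open>[i] : Y(lambda) -> Z(xi) well defined (N1, N2 the null families of lambda, xi).\<close>
definition incl_wd :: "'a set set \<Rightarrow> ('a \<Rightarrow> real) set \<Rightarrow> 'a set set \<Rightarrow> ('a \<Rightarrow> real) set \<Rightarrow> bool" where
  "incl_wd N1 Y N2 Z \<longleftrightarrow> N1 \<subseteq> N2 \<and> Y \<subseteq> Z"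

definition delta_ring_of :: "'a measure \<Rightarrow> ('a \<Rightarrow> real) set \<Rightarrow> 'a set set" where
  "delta_ring_of M X = {A \<in> sets M. (indicator A :: 'a \<Rightarrow> real) \<in> X}"

definition vmeas :: "(('a \<Rightarrow> real) \<Rightarrow> 'e) \<Rightarrow> 'a set \<Rightarrow> 'e" where
  "vmeas T A = T (indicator A)"

definition var_fn :: "'a set set \<Rightarrow> ('a set \<Rightarrow> real) \<Rightarrow> 'a set \<Rightarrow> ennreal" where
  "var_fn R \<nu> A = (SUP P\<in>{P. finite P \<and> disjoint P \<and> P \<subseteq> R \<and> \<Union>P \<subseteq> A}. \<Sum>B\<in>P. ennreal \<bar>\<nu> B\<bar>)"

definition var_meas :: "'a measure \<Rightarrow> 'a set set \<Rightarrow> ('a set \<Rightarrow> real) \<Rightarrow> 'a measure" where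
  "var_meas M R \<nu> = measure_of (space M) (sets M) (var_fn R \<nu>)"

definition posv_meas :: "'a measure \<Rightarrow> 'a set set \<Rightarrow> ('a set \<Rightarrow> real) \<Rightarrow> 'a measure" where
  "posv_meas M R \<nu> = measure_of (space M) (sets M) (\<lambda>A. SUP B\<in>{B\<in>R. B \<subseteq> A}. ennreal (\<nu> B))"

definition negv_meas :: "'a measure \<Rightarrow> 'a set set \<Rightarrow> ('a set \<Rightarrow> real) \<Rightarrow> 'a measure" where
  "negv_meas M R \<nu> = measure_of (space M) (sets M) (\<lambda>A. SUP B\<in>{B\<in>R. B \<subseteq> A}. ennreal (- \<nu> B))"

definition sint :: "'a measure \<Rightarrow> 'a set set \<Rightarrow> ('a set \<Rightarrow> real) \<Rightarrow> 'a set \<Rightarrow> ('a \<Rightarrow> real) \<Rightarrow> real" where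
  "sint M R \<nu> A f = integral\<^sup>L (posv_meas M R \<nu>) (\<lambda>x. indicator A x * f x)
                   - integral\<^sup>L (negv_meas M R \<nu>) (\<lambda>x. indicator A x * f x)"

definition semivar :: "'a set set \<Rightarrow> ('a set \<Rightarrow> 'e::real_normed_vector) \<Rightarrow> 'a set \<Rightarrow> ennreal" where
  "semivar R m A = (SUP xs\<in>{xs :: 'e \<Rightarrow> real. bounded_linear xs \<and> onorm xs \<le> 1}. var_fn R (xs \<circ> m) A)"

definition vm_null :: "'a measure \<Rightarrow> 'a set set \<Rightarrow> ('a set \<Rightarrow> 'e::real_normed_vector) \<Rightarrow> 'a set set" where
  "vm_null M R m = {A \<in> sets M. semivar R m A = 0}"

definition vm_L1 :: "'a measure \<Rightarrow> 'a set set \<Rightarrow> ('a set \<Rightarrow> 'e::real_normed_vector) \<Rightarrow> ('a \<Rightarrow> real) set" where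
  "vm_L1 M R m = {f \<in> borel_measurable M.
      (\<forall>xs :: 'e \<Rightarrow> real. bounded_linear xs \<longrightarrow> integrable (var_meas M R (xs \<circ> m)) f)
    \<and> (\<forall>A\<in>sets M. \<exists>v. \<forall>xs :: 'e \<Rightarrow> real. bounded_linear xs \<longrightarrow> xs v = sint M R (xs \<circ> m) A f)}"

definition vm_I :: "'a measure \<Rightarrow> 'a set set \<Rightarrow> ('a set \<Rightarrow> 'e::real_normed_vector) \<Rightarrow> ('a \<Rightarrow> real) \<Rightarrow> 'e" where
  "vm_I M R m f = (THE v. \<forall>xs :: 'e \<Rightarrow> real. bounded_linear xs \<longrightarrow> xs v = sint M R (xs \<circ> m) (space M) f)"

end

theory Submission
  imports Defs
begin

text \<open>
  Fix a functional \<open>xs\<close>. Since \<open>X\<close> is an ideal, \<open>xs \<circ> m\<close> is a countably additive charge on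
  the \<open>\<delta>\<close>-ring, which is hereditary; it is bounded on the subsets of each ring set, and the
  \<open>\<sigma>\<close>-property glues the local Hahn decompositions into a set \<open>P\<close> carrying its positive part.
  If \<open>S\<close> on \<open>Z\<close> extends \<open>T\<close>, then \<open>g \<mapsto> xs (S (g \<cdot> 1\<^sub>P))\<close> is a positive functional that agrees with
  integration against the positive variation on indicators, hence, by order continuity and monotone
  convergence, on all nonnegative \<open>g \<in> Z\<close>; in particular these integrals are finite. The same holds
  for the negative part, so \<open>xs (S (f \<cdot> 1\<^sub>A))\<close> is the integral of \<open>f\<close> over \<open>A\<close> and, functionals
  separating points, \<open>S f\<close> is the vector integral of \<open>f\<close>.
\<close>

subsection \<open>Hahn-Banach separation\<close>

text \<open>The scaling law is one-sided and only for positive \<open>c\<close>, which is easy to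
  check for infima; applying it to \<open>inverse c\<close> recovers equality.\<close>

definition sublinear :: "('e::real_vector \<Rightarrow> real) \<Rightarrow> bool" where
  "sublinear p \<longleftrightarrow> (\<forall>x y. p (x + y) \<le> p x + p y) \<and> (\<forall>c>0. \<forall>x. p (c *\<^sub>R x) \<le> c * p x)"

lemma sublinear_add: "sublinear p \<Longrightarrow> p (x + y) \<le> p x + p y"
  and sublinear_scale_le: "sublinear p \<Longrightarrow> 0 < c \<Longrightarrow> p (c *\<^sub>R x) \<le> c * p x"
  by (auto simp: sublinear_def)

lemma sublinear_zero: "sublinear p \<Longrightarrow> p 0 = 0"
  using sublinear_add[of p 0 0] sublinear_scale_le[of p "1/2" 0] by simp

lemma sublinear_scale:
  assumes "sublinear p" "0 \<le> c" shows "p (c *\<^sub>R x) = c * p x"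
proof (cases "c = 0")
  case False
  then have "c > 0" using assms by simp
  then have "p x \<le> inverse c * p (c *\<^sub>R x)"
    using sublinear_scale_le[OF assms(1), of "inverse c" "c *\<^sub>R x"] by simp
  then have "c * p x \<le> p (c *\<^sub>R x)" using \<open>c > 0\<close> by (simp add: field_simps)
  then show ?thesis using sublinear_scale_le[OF assms(1) \<open>c > 0\<close>, of x] by simp
qed (simp add: sublinear_zero assms)

lemma sublinear_lower: "sublinear p \<Longrightarrow> - p (- x) \<le> p x"
  using sublinear_add[of p x "- x"] sublinear_zero[of p] by simp

text \<open>\<open>q x\<close> is the infimum of \<open>p (x + t *\<^sub>R y) - t * p y\<close> over
  \<open>t \<ge> 0\<close>, the largest sublinear minorant of \<open>p\<close> with the required
  bound at \<open>- y\<close>. Since \<open>q y \<ge> - q (- y) \<ge> p y\<close>, it is linear in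
  the direction \<open>y\<close>.\<close>

lemma sublinear_shift:
  assumes p: "sublinear (p :: 'e::real_vector \<Rightarrow> real)"
  obtains q where "sublinear q" "\<And>x. q x \<le> p x" "q (- y) \<le> - p y"
proof
  let ?f = "\<lambda>x t. p (x + t *\<^sub>R y) - t * p y"
  let ?q = "\<lambda>x. INF t\<in>{0..}. ?f x t"
  \<comment> \<open>A lower bound free of \<open>t\<close> makes the real infimum
    meaningful.\<close>
  have lower: "- p (- x) \<le> ?f x t" if "t \<in> {0..}" for x t
    using sublinear_add[OF p, of "x + t *\<^sub>R y" "- x"] sublinear_scale[OF p, of t y] that by simp
  have le: "?q x \<le> ?f x t" if "t \<ge> 0" for x t
    using that by (intro cINF_lower bdd_belowI2[OF lower]) auto
  have ge: "c \<le> ?q x" if "\<And>t. t \<ge> 0 \<Longrightarrow> c \<le> ?f x t" for c x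
    using that by (intro cINF_greatest) auto
  show "?q x \<le> p x" for x
    using le[of 0 x] by simp
  show "?q (- y) \<le> - p y"
    using le[of 1 "- y"] sublinear_zero[OF p] by simp
  show "sublinear ?q" unfolding sublinear_def
  proof (intro conjI allI impI)
    fix x z
    \<comment> \<open>Parameters \<open>s\<close> for \<open>x\<close> and \<open>t\<close> for
      \<open>z\<close> combine to \<open>s + t\<close>; the two infima are then taken one after the
      other.\<close>
    have *: "?q (x + z) \<le> ?f x s + ?f z t" if "s \<ge> 0" "t \<ge> 0" for s t
      using le[of "s + t" "x + z"] that sublinear_add[OF p, of "x + s *\<^sub>R y" "z + t *\<^sub>R y"]
      by (simp add: algebra_simps)
    have "?q (x + z) - ?f x s \<le> ?q z" if s: "s \<ge> 0" for s
    proof (rule ge)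
      fix t :: real assume "t \<ge> 0"
      then show "?q (x + z) - ?f x s \<le> ?f z t" using *[OF s] by fastforce
    qed
    then have "?q (x + z) - ?q z \<le> ?f x s" if "s \<ge> 0" for s
      using that by fastforce
    then have "?q (x + z) - ?q z \<le> ?q x"
      by (rule ge)
    then show "?q (x + z) \<le> ?q x + ?q z" by simp
  next
    fix c :: real and x assume c: "c > 0"
    have "?q (c *\<^sub>R x) / c \<le> ?q x"
    proof (rule ge)
      fix t :: real assume "t \<ge> 0"
      then have "?q (c *\<^sub>R x) \<le> ?f (c *\<^sub>R x) (c * t)"
        using c by (intro le) simp
      also have "\<dots> = c * ?f x t"
        using sublinear_scale[OF p, of c "x + t *\<^sub>R y"] c by (simp add: algebra_simps)
      finally show "?q (c *\<^sub>R x) / c \<le> ?f x t"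
        using c by (simp add: field_simps)
    qed
    then show "?q (c *\<^sub>R x) \<le> c * ?q x" using c by (simp add: field_simps)
  qed
qed

text \<open>Subadditivity has to bound \<open>p x + q y\<close> for different members
  \<open>p\<close> and \<open>q\<close>; in a chain one \<open>r\<close> lies below both. The common
  majorant \<open>p0\<close> bounds the infima from below by \<open>- p0 (- x)\<close>.\<close>

lemma sublinear_INF_chain:
  assumes ne: "C \<noteq> {}"
    and sub: "\<And>p. p \<in> C \<Longrightarrow> sublinear p"
    and le: "\<And>p x. p \<in> C \<Longrightarrow> p x \<le> p0 x"
    and chain: "\<And>p q. p \<in> C \<Longrightarrow> q \<in> C \<Longrightarrow> (\<forall>x. p x \<le> q x) \<or> (\<forall>x. q x \<le> p x)"
  shows "sublinear (\<lambda>x. INF p\<in>C. p x)" "p \<in> C \<Longrightarrow> (INF p\<in>C. p x) \<le> p x"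
proof -
  have "- p0 (- x) \<le> p x" if "p \<in> C" for p x
    using sublinear_lower[OF sub[OF that], of x] le[OF that, of "- x"] by simp
  then show lower: "(INF p\<in>C. p x) \<le> p x" if "p \<in> C" for p x
    using that by (intro cINF_lower bdd_belowI2) auto
  show "sublinear (\<lambda>x. INF p\<in>C. p x)" unfolding sublinear_def
  proof (intro conjI allI impI)
    fix x y
    have *: "(INF p\<in>C. p (x + y)) \<le> p x + q y" if pq: "p \<in> C" "q \<in> C" for p q
    proof -
      obtain r where r: "r \<in> C" "r x \<le> p x" "r y \<le> q y"
        using chain[OF pq] pq by auto
      show ?thesis
        using lower[OF r(1), of "x + y"] sublinear_add[OF sub[OF r(1)], of x y] r by linarith
    qed
    have "(INF p\<in>C. p (x + y)) - p x \<le> (INF q\<in>C. q y)" if "p \<in> C" for p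
      using *[OF that] by (intro cINF_greatest ne) (simp add: algebra_simps)
    then have "(INF p\<in>C. p (x + y)) - (INF q\<in>C. q y) \<le> (INF p\<in>C. p x)"
      by (intro cINF_greatest ne) (simp add: algebra_simps)
    then show "(INF p\<in>C. p (x + y)) \<le> (INF p\<in>C. p x) + (INF q\<in>C. q y)" by simp
  next
    fix c :: real and x assume c: "c > 0"
    have "(INF p\<in>C. p (c *\<^sub>R x)) / c \<le> (INF p\<in>C. p x)"
    proof (rule cINF_greatest[OF ne])
      fix p assume "p \<in> C"
      then have "(INF p\<in>C. p (c *\<^sub>R x)) \<le> c * p x"
        using lower[of p "c *\<^sub>R x"] sublinear_scale[OF sub, of p c x] c by simp
      then show "(INF p\<in>C. p (c *\<^sub>R x)) / c \<le> p x" using c by (simp add: field_simps)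
    qed
    then show "(INF p\<in>C. p (c *\<^sub>R x)) \<le> c * (INF p\<in>C. p x)" using c by (simp add: field_simps)
  qed
qed

text \<open>A minimal sublinear functional below \<open>p\<close> is linear, because \<open>sublinear_shift\<close> cannot lower it.\<close>

lemma sublinear_dominates_linear:
  assumes p: "sublinear (p :: 'e::real_vector \<Rightarrow> real)"
  obtains f where "linear f" "\<And>x. f x \<le> p x"
proof -
  let ?A = "{q. sublinear q \<and> (\<forall>x. q x \<le> p x)}"
  \<comment> \<open>The order is reversed, so a maximal element for Zorn is a minimal
    functional.\<close>
  let ?P = "\<lambda>q r :: 'e \<Rightarrow> real. \<forall>x. r x \<le> q x"
  have "\<exists>m\<in>?A. \<forall>a\<in>?A. ?P m a \<longrightarrow> a = m"
  proof (rule predicate_Zorn)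
    show "partial_order_on ?A (relation_of ?P ?A)"
      by (rule partial_order_on_relation_ofI) (auto simp: fun_eq_iff intro: order_trans antisym)
    fix C assume C: "C \<in> Chains (relation_of ?P ?A)"
    show "\<exists>u\<in>?A. \<forall>a\<in>C. ?P a u"
    proof (cases "C = {}")
      case True
      then show ?thesis using p by auto
    next
      case False
      have CA: "sublinear q" "q x \<le> p x" if "q \<in> C" for q x
        using that C by (auto simp: Chains_def relation_of_def)
      have chain: "(\<forall>x. q x \<le> r x) \<or> (\<forall>x. r x \<le> q x)" if "q \<in> C" "r \<in> C" for q r
        using that C by (auto simp: Chains_def relation_of_def)
      let ?u = "\<lambda>x. INF q\<in>C. q x"
      have *: "sublinear ?u" "\<And>q x. q \<in> C \<Longrightarrow> ?u x \<le> q x"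
        by (rule sublinear_INF_chain[of C p]; use False CA chain in blast)+
      obtain r where "r \<in> C" using False by auto
      then have "?u x \<le> p x" for x
        using *(2)[of r x] CA(2)[of r x] by linarith
      then show ?thesis using * by (intro bexI[of _ ?u]) auto
    qed
  qed
  then obtain m where m: "sublinear m" "\<And>x. m x \<le> p x"
    and min: "\<And>a. sublinear a \<Longrightarrow> (\<And>x. a x \<le> p x) \<Longrightarrow> (\<And>x. a x \<le> m x) \<Longrightarrow> a = m"
    by blast
  have neg: "m (- y) = - m y" for y
  proof -
    obtain q where q: "sublinear q" "\<And>x. q x \<le> m x" "q (- y) \<le> - m y"
      using sublinear_shift[OF m(1)] by blast
    \<comment> \<open>Minimality turns the shift at \<open>y\<close> into
      \<open>m (- y) \<le> - m y\<close>; the other inequality holds for every sublinear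
      functional.\<close>
    have "q = m" using q m(2) by (intro min) (auto intro: order_trans)
    then show ?thesis using q(3) sublinear_lower[OF m(1), of "- y"] by simp
  qed
  have "linear m"
  proof (rule linearI)
    fix x y show "m (x + y) = m x + m y"
      using sublinear_add[OF m(1), of x y] sublinear_add[OF m(1), of "x + y" "- y"] neg[of y] by simp
  next
    fix c x show "m (c *\<^sub>R x) = c *\<^sub>R m x"
      using sublinear_scale[OF m(1), of c x] sublinear_scale[OF m(1), of "- c" x] neg[of "c *\<^sub>R x"]
      by (cases "c \<ge> 0") auto
  qed
  with m(2) show thesis using that by blast
qed

text \<open>Shifting the norm along \<open>v\<close> first forces every linear \<open>f\<close>
  below the result to satisfy \<open>f (- v) \<le> - norm v\<close>, that is
  \<open>f v \<ge> norm v\<close>.\<close>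

lemma separating_functional:
  fixes v :: "'e::real_normed_vector"
  assumes "v \<noteq> 0"
  obtains f :: "'e \<Rightarrow> real" where "bounded_linear f" "f v \<noteq> 0"
proof -
  have "sublinear (norm :: 'e \<Rightarrow> real)"
    by (auto simp: sublinear_def norm_triangle_ineq)
  from sublinear_shift[OF this, of v] obtain q :: "'e \<Rightarrow> real"
    where q: "sublinear q" "\<And>x. q x \<le> norm x" "q (- v) \<le> - norm v" by blast
  obtain f where f: "linear f" "\<And>x. f x \<le> q x"
    using sublinear_dominates_linear[OF q(1)] by blast
  interpret f: linear f by (rule f)
  have le: "f x \<le> norm x" for x using f(2) q(2) order_trans by blast
  have "\<bar>f x\<bar> \<le> norm x" for x using le[of x] le[of "- x"] by (simp add: f.neg)
  then have "bounded_linear f"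
    by (intro bounded_linear_intro[where K=1]) (auto simp: f.add f.scaleR)
  moreover have "f v \<noteq> 0"
    using f(2)[of "- v"] q(3) f.neg[of v] zero_less_norm_iff[of v] assms by linarith
  ultimately show thesis using that by blast
qed

lemma functionals_separate:
  fixes v w :: "'e::real_normed_vector"
  assumes "\<And>xs :: 'e \<Rightarrow> real. bounded_linear xs \<Longrightarrow> xs v = xs w"
  shows "v = w"
proof (rule ccontr)
  assume "v \<noteq> w"
  then obtain f :: "'e \<Rightarrow> real" where f: "bounded_linear f" "f (v - w) \<noteq> 0"
    using separating_functional[of "v - w"] by auto
  then show False using assms[of f] by (simp add: bounded_linear.linear linear_diff)
qed

subsection \<open>Positive and negative variation of a charge on a hereditary ring\<close>

text \<open>This is the positive variation: \<open>ennreal\<close> replaces negative values by 0.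
  The negative variation is the same function for \<open>- \<nu>\<close>.\<close>

definition sup_charge :: "'a set set \<Rightarrow> ('a set \<Rightarrow> real) \<Rightarrow> 'a set \<Rightarrow> ennreal" where
  "sup_charge R \<nu> A = (SUP B\<in>{B\<in>R. B \<subseteq> A}. ennreal (\<nu> B))"

lemma negv_meas_eq: "negv_meas M R \<nu> = posv_meas M R (\<lambda>B. - \<nu> B)"
  by (simp add: negv_meas_def posv_meas_def)

lemma ennreal_add_le: "ennreal (a + b) \<le> ennreal a + ennreal b"
  by (cases "a \<ge> 0"; cases "b \<ge> 0")
     (auto simp: ennreal_neg intro!: ennreal_leI order_trans[OF ennreal_leI])

lemma ennreal_abs_eq: "ennreal \<bar>a\<bar> = ennreal a + ennreal (- a)"
  by (cases "a \<ge> 0") (auto simp: ennreal_neg)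

lemma sets_posv_meas [simp, measurable_cong]: "sets (posv_meas M R \<nu>) = sets M"
  and space_posv_meas [simp]: "space (posv_meas M R \<nu>) = space M"
  and sets_var_meas [simp, measurable_cong]: "sets (var_meas M R \<nu>) = sets M"
  and space_var_meas [simp]: "space (var_meas M R \<nu>) = space M"
  and sets_negv_meas [simp, measurable_cong]: "sets (negv_meas M R \<nu>) = sets M"
  and space_negv_meas [simp]: "space (negv_meas M R \<nu>) = space M"
  by (simp_all add: posv_meas_def var_meas_def negv_meas_def)

text \<open>Models \<open>xs \<circ> vmeas T\<close> on the delta-ring of \<open>X\<close>, which is
  hereditary because \<open>X\<close> is an ideal. The whole space need not lie in \<open>R\<close>,
  so additivity is asked for only when the union stays in \<open>R\<close>.\<close>

locale charge =
  fixes M :: "'a measure" and R :: "'a set set" and \<nu> :: "'a set \<Rightarrow> real"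
  assumes R_sets: "R \<subseteq> sets M"
    and empty_R [simp]: "{} \<in> R"
    and hered: "A \<in> R \<Longrightarrow> B \<in> sets M \<Longrightarrow> B \<subseteq> A \<Longrightarrow> B \<in> R"
    and Un_R: "A \<in> R \<Longrightarrow> B \<in> R \<Longrightarrow> A \<union> B \<in> R"
    and sums: "range D \<subseteq> R \<Longrightarrow> disjoint_family D \<Longrightarrow> (\<Union>i. D i) \<in> R
      \<Longrightarrow> (\<lambda>i::nat. \<nu> (D i)) sums \<nu> (\<Union>i. D i)"
begin

lemma in_sets: "A \<in> R \<Longrightarrow> A \<in> sets M"
  using R_sets by auto

lemma Int_R: "A \<in> R \<Longrightarrow> B \<in> sets M \<Longrightarrow> A \<inter> B \<in> R"
  by (rule hered[of A]) (auto dest: in_sets)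

lemma Diff_R: "A \<in> R \<Longrightarrow> B \<in> sets M \<Longrightarrow> A - B \<in> R"
  by (rule hered[of A]) (auto dest: in_sets)

lemma uminus_charge: "charge M R (\<lambda>B. - \<nu> B)"
  by unfold_locales (fact R_sets empty_R hered Un_R sums_minus[OF sums])+

lemma nu_empty [simp]: "\<nu> {} = 0"
proof -
  have "(\<lambda>i::nat. \<nu> {}) sums \<nu> (\<Union>i::nat. {})"
    by (rule sums) (auto simp: disjoint_family_on_def)
  then show ?thesis by (auto dest: sums_summable simp: summable_const_iff)
qed

lemma nu_Un:
  assumes "A \<in> R" "B \<in> R" "A \<inter> B = {}"
  shows "\<nu> (A \<union> B) = \<nu> A + \<nu> B"
proof -
  have "(\<lambda>i. \<nu> (binaryset A B i)) sums \<nu> (\<Union>i. binaryset A B i)"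
  proof (rule sums)
    show "range (binaryset A B) \<subseteq> R" using assms by (simp add: range_binaryset_eq)
    show "disjoint_family (binaryset A B)"
      using assms(3) by (simp add: disjoint_family_on_def binaryset_def Int_commute)
    show "(\<Union>i. binaryset A B i) \<in> R" using assms by (simp add: UN_binaryset_eq Un_R)
  qed
  with binaryset_sums[of \<nu> A B] show ?thesis
    by (auto simp: UN_binaryset_eq dest: sums_unique2)
qed

lemma nu_split:
  assumes "A \<in> R" "B \<in> sets M"
  shows "\<nu> A = \<nu> (A \<inter> B) + \<nu> (A - B)"
  using nu_Un[of "A \<inter> B" "A - B"] Int_R[OF assms] Diff_R[OF assms]
  by (simp add: Int_Diff_Un Int_Diff_disjoint)

lemma nu_Diff: "A \<in> R \<Longrightarrow> B \<in> R \<Longrightarrow> B \<subseteq> A \<Longrightarrow> \<nu> (A - B) = \<nu> A - \<nu> B"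
  using nu_split[of A B] by (simp add: in_sets inf.absorb2)

lemma sums_Int:
  assumes "B \<in> R" "range A \<subseteq> sets M" "disjoint_family A" "B \<subseteq> (\<Union>i. A i)"
  shows "(\<lambda>i. \<nu> (B \<inter> A i)) sums \<nu> B"
proof -
  have "(\<Union>i. B \<inter> A i) = B" using assms by auto
  moreover have "(\<lambda>i. \<nu> (B \<inter> A i)) sums \<nu> (\<Union>i. B \<inter> A i)"
  proof (rule sums)
    show "range (\<lambda>i. B \<inter> A i) \<subseteq> R" using assms by (auto intro: Int_R)
    show "disjoint_family (\<lambda>i. B \<inter> A i)" using assms(3) by (auto simp: disjoint_family_on_def)
    show "(\<Union>i. B \<inter> A i) \<in> R" using calculation assms by simp
  qed
  ultimately show ?thesis by simp
qed

section \<open>The positive variation as a measure\<close>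

lemma sup_charge_upper: "B \<in> R \<Longrightarrow> B \<subseteq> A \<Longrightarrow> ennreal (\<nu> B) \<le> sup_charge R \<nu> A"
  unfolding sup_charge_def by (rule SUP_upper) auto

lemma sup_charge_least: "(\<And>B. B \<in> R \<Longrightarrow> B \<subseteq> A \<Longrightarrow> ennreal (\<nu> B) \<le> c) \<Longrightarrow> sup_charge R \<nu> A \<le> c"
  unfolding sup_charge_def by (rule SUP_least) auto

text \<open>Sums of two suprema can be bounded by fixing one set at a time: the index family
  contains \<open>{}\<close>, so addition commutes with the supremum.\<close>

lemma sup_charge_plus_least:
  assumes "\<And>B. B \<in> R \<Longrightarrow> B \<subseteq> A \<Longrightarrow> ennreal (\<nu> B) + d \<le> c"
  shows "sup_charge R \<nu> A + d \<le> c"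
  unfolding sup_charge_def
  by (subst ennreal_SUP_add_left[symmetric]) (auto intro!: SUP_least assms exI[of _ "{}"])

lemma sup_charge_empty [simp]: "sup_charge R \<nu> {} = 0"
  using sup_charge_least[of "{}" 0] by fastforce

lemma sup_charge_superadd:
  assumes "A \<inter> B = {}"
  shows "sup_charge R \<nu> A + sup_charge R \<nu> B \<le> sup_charge R \<nu> (A \<union> B)"
proof (rule sup_charge_plus_least)
  fix C assume C: "C \<in> R" "C \<subseteq> A"
  have "sup_charge R \<nu> B + ennreal (\<nu> C) \<le> sup_charge R \<nu> (A \<union> B)"
  proof (rule sup_charge_plus_least)
    fix D assume D: "D \<in> R" "D \<subseteq> B"
    have "C \<inter> D = {}" using C D assms by auto
    then have un: "\<nu> (C \<union> D) = \<nu> C + \<nu> D" using C D by (intro nu_Un)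
    \<comment> \<open>If one value is negative, \<open>ennreal\<close> truncates it to 0 and the
      other set alone competes; otherwise the union does.\<close>
    have *: "ennreal (\<nu> X) \<le> sup_charge R \<nu> (A \<union> B)" if "X \<in> {C, D, C \<union> D}" for X
      using that C D Un_R[of C D] by (intro sup_charge_upper) auto
    show "ennreal (\<nu> D) + ennreal (\<nu> C) \<le> sup_charge R \<nu> (A \<union> B)"
      using *[of C] *[of D] *[of "C \<union> D"] un
      by (cases "\<nu> C \<ge> 0"; cases "\<nu> D \<ge> 0") (auto simp: ennreal_neg ennreal_plus[symmetric] add.commute simp del: ennreal_plus)
  qed
  then show "ennreal (\<nu> C) + sup_charge R \<nu> B \<le> sup_charge R \<nu> (A \<union> B)"
    by (simp add: add.commute)
qed

lemma sup_charge_mono: "A \<subseteq> B \<Longrightarrow> sup_charge R \<nu> A \<le> sup_charge R \<nu> B"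
  by (intro sup_charge_least sup_charge_upper) auto

text \<open>Superadditivity on finite unions bounds the series by the value of the union. Conversely
  a ring set \<open>B\<close> is sliced by the \<open>A i\<close>: as \<open>ennreal\<close> is
  subadditive, the partial sums of \<open>\<nu> (B \<inter> A i)\<close> stay below those of the
  variations, and they converge to \<open>\<nu> B\<close>.\<close>

lemma sup_charge_countably_additive: "countably_additive (sets M) (sup_charge R \<nu>)"
proof (rule countably_additiveI)
  fix A :: "nat \<Rightarrow> 'a set"
  assume A: "range A \<subseteq> sets M" "disjoint_family A"
  have "(\<Sum>i<n. sup_charge R \<nu> (A i)) \<le> sup_charge R \<nu> (\<Union>i<n. A i)" for n
  proof (induction n)
    case (Suc n)
    have "(\<Sum>i<Suc n. sup_charge R \<nu> (A i)) \<le> sup_charge R \<nu> (\<Union>i<n. A i) + sup_charge R \<nu> (A n)"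
      using Suc by (simp add: add_right_mono)
    also have "\<dots> \<le> sup_charge R \<nu> ((\<Union>i<n. A i) \<union> A n)"
      using disjoint_family_onD[OF A(2) UNIV_I UNIV_I less_imp_neq, of _ n]
      by (intro sup_charge_superadd) auto
    finally show ?case by (simp add: lessThan_Suc Un_commute)
  qed simp
  moreover have "sup_charge R \<nu> (\<Union>i<n. A i) \<le> sup_charge R \<nu> (\<Union>i. A i)" for n
    by (rule sup_charge_mono) auto
  ultimately have "(\<Sum>i<n. sup_charge R \<nu> (A i)) \<le> sup_charge R \<nu> (\<Union>i. A i)" for n
    by (rule order_trans)
  then have "(\<Sum>i. sup_charge R \<nu> (A i)) \<le> sup_charge R \<nu> (\<Union>i. A i)"
    by (intro suminf_le_const) auto
  moreover have "sup_charge R \<nu> (\<Union>i. A i) \<le> (\<Sum>i. sup_charge R \<nu> (A i))"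
  proof (rule sup_charge_least)
    fix B assume B: "B \<in> R" "B \<subseteq> (\<Union>i. A i)"
    have "(\<lambda>n. \<Sum>i<n. \<nu> (B \<inter> A i)) \<longlonglongrightarrow> \<nu> B"
      using sums_Int[OF B(1) A B(2)] by (simp add: sums_def)
    then have lim: "(\<lambda>n. ennreal (\<Sum>i<n. \<nu> (B \<inter> A i))) \<longlonglongrightarrow> ennreal (\<nu> B)"
      by (rule tendsto_ennrealI)
    have "ennreal (\<Sum>i<n. \<nu> (B \<inter> A i)) \<le> (\<Sum>i<n. sup_charge R \<nu> (A i))" for n
    proof (induction n)
      case (Suc n)
      have "ennreal (\<nu> (B \<inter> A n)) \<le> sup_charge R \<nu> (A n)"
        using A B by (intro sup_charge_upper Int_R) auto
      with Suc have "ennreal (\<Sum>i<n. \<nu> (B \<inter> A i)) + ennreal (\<nu> (B \<inter> A n))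
        \<le> (\<Sum>i<n. sup_charge R \<nu> (A i)) + sup_charge R \<nu> (A n)"
        by (rule add_mono)
      from order_trans[OF ennreal_add_le this] show ?case by simp
    qed simp
    moreover have "(\<Sum>i<n. sup_charge R \<nu> (A i)) \<le> (\<Sum>i. sup_charge R \<nu> (A i))" for n
      by (rule sum_le_suminf) auto
    ultimately have "ennreal (\<Sum>i<n. \<nu> (B \<inter> A i)) \<le> (\<Sum>i. sup_charge R \<nu> (A i))" for n
      by (rule order_trans)
    then show "ennreal (\<nu> B) \<le> (\<Sum>i. sup_charge R \<nu> (A i))"
      by (intro LIMSEQ_le_const2[OF lim]) auto
  qed
  ultimately show "(\<Sum>i. sup_charge R \<nu> (A i)) = sup_charge R \<nu> (\<Union>i. A i)"
    by (rule antisym)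
qed

text \<open>\<open>measure_of\<close> yields the zero measure unless its set function is a measure;
  countable additivity excludes that default.\<close>

lemma emeasure_posv:
  assumes "A \<in> sets M"
  shows "emeasure (posv_meas M R \<nu>) A = sup_charge R \<nu> A"
proof (rule emeasure_measure_of)
  show "posv_meas M R \<nu> = measure_of (space M) (sets M) (sup_charge R \<nu>)"
    by (simp add: posv_meas_def sup_charge_def[abs_def])
  show "positive (sets (posv_meas M R \<nu>)) (sup_charge R \<nu>)"
    by (simp add: positive_def)
  show "countably_additive (sets (posv_meas M R \<nu>)) (sup_charge R \<nu>)"
    using sup_charge_countably_additive by simp
qed (use assms sets.space_closed[of M] in auto)

lemma emeasure_negv:
  "A \<in> sets M \<Longrightarrow> emeasure (negv_meas M R \<nu>) A = sup_charge R (\<lambda>B. - \<nu> B) A"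
  using charge.emeasure_posv[OF uminus_charge] by (simp add: negv_meas_eq)

section \<open>The total variation as a sum of two measures\<close>

lemma var_fn_upper:
  "finite P \<Longrightarrow> disjoint P \<Longrightarrow> P \<subseteq> R \<Longrightarrow> \<Union>P \<subseteq> A \<Longrightarrow> (\<Sum>B\<in>P. ennreal \<bar>\<nu> B\<bar>) \<le> var_fn R \<nu> A"
  unfolding var_fn_def by (rule SUP_upper) auto

lemma var_fn_upper_pair:
  assumes "B \<in> R" "C \<in> R" "B \<inter> C = {}" "B \<subseteq> A" "C \<subseteq> A"
  shows "ennreal \<bar>\<nu> B\<bar> + ennreal \<bar>\<nu> C\<bar> \<le> var_fn R \<nu> A"
\<comment> \<open>Disjoint and equal means both empty; \<open>{B, C}\<close> then has one element,
  but the terms are 0.\<close>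
proof (cases "B = C")
  case True
  then show ?thesis using assms by simp
next
  case False
  then show ?thesis using assms var_fn_upper[of "{B, C}" A]
    by (simp add: disjoint_def Int_commute)
qed

text \<open>Argued with suprema alone, before any Hahn set is at hand. Splitting each absolute value
  into positive and negative part bounds every finite family; the converse combines competitors
  \<open>B\<close> and \<open>C\<close> for the two variations.\<close>

lemma var_fn_eq:
  assumes A: "A \<in> sets M"
  shows "var_fn R \<nu> A = sup_charge R \<nu> A + sup_charge R (\<lambda>B. - \<nu> B) A"
proof (rule antisym)
  interpret m: charge M R "\<lambda>B. - \<nu> B" by (rule uminus_charge)
  show "var_fn R \<nu> A \<le> sup_charge R \<nu> A + sup_charge R (\<lambda>B. - \<nu> B) A"
    unfolding var_fn_def
  proof (rule SUP_least, safe)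
    fix P assume P: "finite P" "disjoint P" "P \<subseteq> R" "\<Union>P \<subseteq> A"
    have bound: "(\<Sum>B\<in>P. ennreal (\<mu> B)) \<le> sup_charge R \<mu> A" if "charge M R \<mu>" for \<mu>
    proof -
      interpret u: charge M R \<mu> by (rule that)
      have PM: "P \<subseteq> sets M" using P R_sets by auto
      have "(\<Sum>B\<in>P. ennreal (\<mu> B)) \<le> (\<Sum>B\<in>P. emeasure (posv_meas M R \<mu>) B)"
        using P by (intro sum_mono) (auto simp: u.emeasure_posv[OF subsetD[OF PM]] intro!: u.sup_charge_upper)
      also have "\<dots> = emeasure (posv_meas M R \<mu>) (\<Union>B\<in>P. B)"
        using P PM by (intro sum_emeasure) (auto simp: disjoint_family_on_def disjoint_def)
      also have "\<dots> \<le> emeasure (posv_meas M R \<mu>) A"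
        using P A by (intro emeasure_mono) auto
      finally show ?thesis using A by (simp add: u.emeasure_posv)
    qed
    show "(\<Sum>B\<in>P. ennreal \<bar>\<nu> B\<bar>) \<le> sup_charge R \<nu> A + sup_charge R (\<lambda>B. - \<nu> B) A"
      using bound[OF charge_axioms] bound[OF uminus_charge]
      by (simp add: ennreal_abs_eq sum.distrib add_mono)
  qed
  show "sup_charge R \<nu> A + sup_charge R (\<lambda>B. - \<nu> B) A \<le> var_fn R \<nu> A"
  proof (rule sup_charge_plus_least)
    fix B assume B: "B \<in> R" "B \<subseteq> A"
    have "sup_charge R (\<lambda>B. - \<nu> B) A + ennreal (\<nu> B) \<le> var_fn R \<nu> A"
    proof (rule m.sup_charge_plus_least)
      fix C assume C: "C \<in> R" "C \<subseteq> A"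
      have one: "ennreal \<bar>\<nu> X\<bar> \<le> var_fn R \<nu> A" if "X \<in> {B, C}" for X
        using var_fn_upper_pair[of X "{}" A] that B C by auto
      \<comment> \<open>\<open>B\<close> and \<open>C\<close> may overlap; their common part cancels
        and leaves two disjoint sets.\<close>
      have "\<nu> B - \<nu> C = \<nu> (B - C) - \<nu> (C - B)"
        using nu_split[OF B(1) in_sets[OF C(1)]] nu_split[OF C(1) in_sets[OF B(1)]] Int_commute[of B C]
        by simp
      then have "ennreal (\<nu> B - \<nu> C) \<le> ennreal (\<bar>\<nu> (B - C)\<bar> + \<bar>\<nu> (C - B)\<bar>)"
        by (intro ennreal_leI) simp
      also have "\<dots> \<le> var_fn R \<nu> A"
        using B C var_fn_upper_pair[of "B - C" "C - B" A] by (auto intro: Diff_R in_sets)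
      finally have "ennreal (\<nu> B - \<nu> C) \<le> var_fn R \<nu> A" .
      then show "ennreal (- \<nu> C) + ennreal (\<nu> B) \<le> var_fn R \<nu> A"
        using one[of B] one[of C]
        by (cases "\<nu> B \<ge> 0"; cases "\<nu> C \<le> 0") (auto simp: ennreal_neg ennreal_plus[symmetric] simp del: ennreal_plus)
    qed
    then show "ennreal (\<nu> B) + sup_charge R (\<lambda>B. - \<nu> B) A \<le> var_fn R \<nu> A"
      by (simp add: add.commute)
  qed
qed

lemma emeasure_var:
  assumes "A \<in> sets M"
  shows "emeasure (var_meas M R \<nu>) A
    = emeasure (posv_meas M R \<nu>) A + emeasure (negv_meas M R \<nu>) A"
proof -
  have eq: "var_fn R \<nu> B = emeasure (posv_meas M R \<nu>) B + emeasure (negv_meas M R \<nu>) B"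
    if "B \<in> sets M" for B
    using that by (simp add: var_fn_eq emeasure_posv emeasure_negv)
  have "emeasure (var_meas M R \<nu>) A = var_fn R \<nu> A"
  proof (rule emeasure_measure_of[OF var_meas_def])
    show "positive (sets (var_meas M R \<nu>)) (var_fn R \<nu>)"
      by (simp add: positive_def eq)
    show "countably_additive (sets (var_meas M R \<nu>)) (var_fn R \<nu>)"
    proof (rule countably_additiveI)
      fix B :: "nat \<Rightarrow> 'a set"
      assume B: "range B \<subseteq> sets (var_meas M R \<nu>)" "disjoint_family B"
        "(\<Union>i. B i) \<in> sets (var_meas M R \<nu>)"
      have "(\<Sum>i. var_fn R \<nu> (B i))
        = (\<Sum>i. emeasure (posv_meas M R \<nu>) (B i)) + (\<Sum>i. emeasure (negv_meas M R \<nu>) (B i))"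
        using B by (subst suminf_add) (auto intro!: suminf_cong eq)
      also have "\<dots> = var_fn R \<nu> (\<Union>i. B i)"
        using B by (subst eq) (auto simp: suminf_emeasure negv_meas_eq)
      finally show "(\<Sum>i. var_fn R \<nu> (B i)) = var_fn R \<nu> (\<Union>i. B i)" .
    qed
  qed (use assms sets.space_closed[of M] in auto)
  with eq[OF assms] show ?thesis by simp
qed

text \<open>Measurable induction starting from \<open>emeasure_var\<close>; each step is proved for
  a generic \<open>L\<close>, to serve the variation and both its parts.\<close>

lemma nn_integral_var:
  assumes "f \<in> borel_measurable M"
  shows "(\<integral>\<^sup>+x. f x \<partial>var_meas M R \<nu>)
    = (\<integral>\<^sup>+x. f x \<partial>posv_meas M R \<nu>) + (\<integral>\<^sup>+x. f x \<partial>negv_meas M R \<nu>)"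
  unfolding negv_meas_eq using assms
proof (induction rule: borel_measurable_induct)
  case (cong f g)
  have "(\<integral>\<^sup>+x. f x \<partial>L) = (\<integral>\<^sup>+x. g x \<partial>L)" if "space L = space M" for L
    using that cong by (intro nn_integral_cong) auto
  then show ?case using cong by simp
next
  case (set A)
  then show ?case using emeasure_var by (simp add: negv_meas_eq)
next
  case (mult u c)
  have "(\<integral>\<^sup>+x. c * u x \<partial>L) = c * (\<integral>\<^sup>+x. u x \<partial>L)" if "sets L = sets M" for L
    using that mult by (intro nn_integral_cmult) (simp add: measurable_cong_sets[OF that refl])
  then show ?case using mult by (simp add: distrib_left)
next
  case (add u v)
  have "(\<integral>\<^sup>+x. v x + u x \<partial>L) = (\<integral>\<^sup>+x. v x \<partial>L) + (\<integral>\<^sup>+x. u x \<partial>L)" if "sets L = sets M" for L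
    using that add by (intro nn_integral_add) (simp_all add: measurable_cong_sets[OF that refl])
  then show ?case using add by (simp add: ac_simps)
next
  case (seq U)
  have "(\<integral>\<^sup>+x. (SUP i. U i) x \<partial>L) = (SUP i. \<integral>\<^sup>+x. U i x \<partial>L)" if "sets L = sets M" for L
    unfolding SUP_apply
    using that seq by (intro nn_integral_monotone_convergence_SUP) (simp_all add: measurable_cong_sets[OF that refl])
  moreover have "incseq (\<lambda>i. \<integral>\<^sup>+x. U i x \<partial>L)" for L
    using seq by (auto simp: incseq_def le_fun_def intro!: nn_integral_mono)
  ultimately show ?case using seq by (simp add: ennreal_SUP_add)
qed

section \<open>Local boundedness and the Hahn decomposition\<close>

lemma bounded_on:
  assumes "A \<in> R"
  shows "\<exists>K. \<forall>B\<in>sets M. B \<subseteq> A \<longrightarrow> \<bar>\<nu> B\<bar> \<le> K"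
proof (rule ccontr)
  \<comment> \<open>From an unbounded set one chooses a decreasing sequence of unbounded sets whose
    successive differences have \<open>\<nu>\<close> of modulus at least 1; countable additivity
    would force these values to tend to 0.\<close>
  define unb where "unb = (\<lambda>A. A \<in> R \<and> (\<forall>K. \<exists>B\<in>sets M. B \<subseteq> A \<and> \<bar>\<nu> B\<bar> > K))"
  have bdd: "\<exists>K. \<forall>B\<in>sets M. B \<subseteq> A \<longrightarrow> \<bar>\<nu> B\<bar> \<le> K" if "A \<in> R" "\<not> unb A" for A
    using that by (auto simp: unb_def not_less)
  assume "\<not> ?thesis"
  with bdd[OF assms] have A: "unb A" by blast
  have step: "\<exists>A'. unb A' \<and> (A' \<subseteq> A \<and> \<bar>\<nu> (A - A')\<bar> \<ge> 1)" if "unb A" for A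
  proof -
    from that have AR: "A \<in> R" by (simp add: unb_def)
    \<comment> \<open>The margin \<open>\<bar>\<nu> A\<bar> + 1\<close> makes both
      \<open>\<nu> B\<close> and \<open>\<nu> (A - B)\<close> exceed 1 in modulus, so either half
      may be the discarded one.\<close>
    from that obtain B where B: "B \<in> sets M" "B \<subseteq> A" "\<bar>\<nu> B\<bar> > \<bar>\<nu> A\<bar> + 1"
      by (auto simp: unb_def)
    then have BR: "B \<in> R" using AR hered by auto
    have d: "\<nu> (A - B) = \<nu> A - \<nu> B" using AR BR B by (simp add: nu_Diff)
    have "unb B \<or> unb (A - B)"
    proof (rule ccontr)
      assume "\<not> ?thesis"
      then obtain K1 K2 where K: "\<And>C. C \<in> sets M \<Longrightarrow> C \<subseteq> B \<Longrightarrow> \<bar>\<nu> C\<bar> \<le> K1"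
          "\<And>C. C \<in> sets M \<Longrightarrow> C \<subseteq> A - B \<Longrightarrow> \<bar>\<nu> C\<bar> \<le> K2"
        using bdd[OF BR] bdd[OF Diff_R[OF AR B(1)]] by metis
      from \<open>unb A\<close> obtain C where C: "C \<in> sets M" "C \<subseteq> A" "\<bar>\<nu> C\<bar> > K1 + K2"
        unfolding unb_def by blast
      have "\<nu> C = \<nu> (C \<inter> B) + \<nu> (C - B)"
        using AR C B by (intro nu_split) (auto intro: hered)
      moreover have "\<bar>\<nu> (C \<inter> B)\<bar> \<le> K1" "\<bar>\<nu> (C - B)\<bar> \<le> K2"
        using B C by (auto intro!: K)
      ultimately show False using C(3) by linarith
    qed
    then show ?thesis
    proof
      assume "unb B" then show ?thesis using B d by (intro exI[of _ B]) auto
    next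
      assume "unb (A - B)"
      moreover have "A - (A - B) = B" using B by auto
      ultimately show ?thesis using B by (intro exI[of _ "A - B"]) auto
    qed
  qed
  have "\<exists>f. \<forall>n::nat. unb (f n) \<and> (f (Suc n) \<subseteq> f n \<and> \<bar>\<nu> (f n - f (Suc n))\<bar> \<ge> 1)"
    by (rule dependent_nat_choice) (use A step in blast)+
  then obtain f where f: "\<And>n::nat. unb (f n)" "\<And>n. f (Suc n) \<subseteq> f n"
      "\<And>n. \<bar>\<nu> (f n - f (Suc n))\<bar> \<ge> 1"
    by blast
  have fR: "f n \<in> R" for n using f(1) by (simp add: unb_def)
  have anti: "f n \<subseteq> f m" if "m \<le> n" for m n
    using lift_Suc_antimono_le[of f, OF f(2) that] .
  let ?D = "\<lambda>n. f n - f (Suc n)"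
  have DR: "?D n \<in> R" for n using Diff_R[OF fR in_sets[OF fR]] .
  have "(\<lambda>n. \<nu> (?D n)) sums \<nu> (\<Union>n. ?D n)"
  proof (rule sums)
    show "range ?D \<subseteq> R" using DR by auto
    have "?D m \<inter> ?D n = {}" if "m < n" for m n
      using anti[of "Suc m" n] that by auto
    then show "disjoint_family ?D"
      unfolding disjoint_family_on_def by (metis Int_commute linorder_neqE_nat)
    show "(\<Union>n. ?D n) \<in> R"
    proof (rule hered[OF fR[of 0]])
      show "(\<Union>n. ?D n) \<in> sets M" using DR in_sets by (intro sets.countable_UN) auto
      show "(\<Union>n. ?D n) \<subseteq> f 0" using anti[of 0] by blast
    qed
  qed
  then have "(\<lambda>n. \<bar>\<nu> (?D n)\<bar>) \<longlonglongrightarrow> 0"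
    by (intro tendsto_rabs_zero summable_LIMSEQ_zero sums_summable)
  then have "(1::real) \<le> 0"
    by (rule LIMSEQ_le_const) (use f(3) in auto)
  then show False by simp
qed

lemma sup_charge_finite: "A \<in> R \<Longrightarrow> sup_charge R \<nu> A < top"
proof -
  assume "A \<in> R"
  then obtain K where K: "\<forall>B\<in>sets M. B \<subseteq> A \<longrightarrow> \<bar>\<nu> B\<bar> \<le> K" using bounded_on by blast
  have "sup_charge R \<nu> A \<le> ennreal K"
    using K in_sets by (intro sup_charge_least ennreal_leI) fastforce
  then show ?thesis using le_less_trans ennreal_less_top by blast
qed

text \<open>Every competitor \<open>B\<close> satisfies
  \<open>\<nu> B = \<nu> A - \<nu> (A - B)\<close>, and the last term is controlled by the negative
  variation. This is one half of the Jordan decomposition, arranged so that nothing is subtracted in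
  \<open>ennreal\<close>.\<close>

lemma jordan_le:
  assumes "A \<in> R"
  shows "sup_charge R \<nu> A + ennreal (- \<nu> A) \<le> sup_charge R (\<lambda>B. - \<nu> B) A + ennreal (\<nu> A)"
proof (rule sup_charge_plus_least)
  interpret m: charge M R "\<lambda>B. - \<nu> B" by (rule uminus_charge)
  fix B assume B: "B \<in> R" "B \<subseteq> A"
  have "A - B \<in> R" using B assms by (auto intro: Diff_R in_sets)
  then have "ennreal (- \<nu> (A - B)) \<le> sup_charge R (\<lambda>B. - \<nu> B) A" "ennreal (- \<nu> A) \<le> sup_charge R (\<lambda>B. - \<nu> B) A"
    using assms by (auto intro: m.sup_charge_upper)
  note * = this
  have d: "\<nu> (A - B) = \<nu> A - \<nu> B" using assms B by (simp add: nu_Diff)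
  show "ennreal (\<nu> B) + ennreal (- \<nu> A) \<le> sup_charge R (\<lambda>B. - \<nu> B) A + ennreal (\<nu> A)"
  proof (cases "\<nu> B \<ge> 0")
    case True
    show ?thesis
    proof (cases "\<nu> A \<ge> 0")
      case nn: True
      have "ennreal (\<nu> B) \<le> ennreal (- \<nu> (A - B)) + ennreal (\<nu> A)"
        using ennreal_add_le[of "- \<nu> (A - B)" "\<nu> A"] d by simp
      also have "\<dots> \<le> sup_charge R (\<lambda>B. - \<nu> B) A + ennreal (\<nu> A)"
        using * by (intro add_mono) auto
      finally show ?thesis using nn by (simp add: ennreal_neg)
    next
      case False
      then show ?thesis using True * d
        by (auto simp: ennreal_neg ennreal_plus[symmetric] simp del: ennreal_plus)
    qed
  next
    case False
    then show ?thesis using * by (auto simp: ennreal_neg intro: add_increasing2)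
  qed
qed

text \<open>If \<open>\<nu> A\<close> were negative, \<open>jordan_le\<close> would put the positive
  variation plus \<open>- \<nu> A\<close> below the positive variation itself, which is finite and
  cancels.\<close>

lemma nonneg_of_sup_charge_le:
  assumes "A \<in> R" "sup_charge R (\<lambda>B. - \<nu> B) A \<le> sup_charge R \<nu> A"
  shows "\<nu> A \<ge> 0"
proof (rule ccontr)
  assume neg: "\<not> \<nu> A \<ge> 0"
  then have "sup_charge R \<nu> A + ennreal (- \<nu> A) \<le> sup_charge R (\<lambda>B. - \<nu> B) A"
    using jordan_le[OF assms(1)] by (simp add: ennreal_neg)
  then have "sup_charge R \<nu> A + ennreal (- \<nu> A) \<le> sup_charge R \<nu> A + 0"
    using order_trans[OF _ assms(2)] by simp
  then have "ennreal (- \<nu> A) \<le> 0"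
    using sup_charge_finite[OF assms(1)]
    unfolding ennreal_add_left_cancel_le by auto
  then show False using neg by simp
qed

text \<open>Both variations are finite on \<open>A\<close>, so the Hahn decomposition for two
  unsigned measures applies; \<open>nonneg_of_sup_charge_le\<close> turns the comparison of
  variations into signs of \<open>\<nu>\<close>.\<close>

lemma hahn_on:
  assumes "A \<in> R"
  shows "\<exists>Y\<in>sets M. Y \<subseteq> A \<and> (\<forall>B\<in>R. B \<subseteq> Y \<longrightarrow> 0 \<le> \<nu> B) \<and> (\<forall>B\<in>R. B \<subseteq> A - Y \<longrightarrow> \<nu> B \<le> 0)"
proof -
  interpret m: charge M R "\<lambda>B. - \<nu> B" by (rule uminus_charge)
  have fin: "sup_charge R \<nu> A \<noteq> top" "sup_charge R (\<lambda>B. - \<nu> B) A \<noteq> top"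
    using sup_charge_finite[OF assms] m.sup_charge_finite[OF assms] by auto
  obtain Y where Y: "Y \<in> sets M" "Y \<subseteq> A"
    "\<And>X. X \<in> sets M \<Longrightarrow> X \<subseteq> Y \<Longrightarrow> sup_charge R (\<lambda>B. - \<nu> B) X \<le> sup_charge R \<nu> X"
    "\<And>X. X \<in> sets M \<Longrightarrow> X \<subseteq> A \<Longrightarrow> X \<inter> Y = {} \<Longrightarrow> sup_charge R \<nu> X \<le> sup_charge R (\<lambda>B. - \<nu> B) X"
    using unsigned_Hahn_decomposition[of "negv_meas M R \<nu>" "posv_meas M R \<nu>" A] fin in_sets[OF assms]
    by (auto simp: emeasure_posv emeasure_negv)
  have "0 \<le> \<nu> B" if "B \<in> R" "B \<subseteq> Y" for B
    using that Y(3)[of B] by (intro nonneg_of_sup_charge_le) (auto intro: in_sets)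
  moreover have "\<nu> B \<le> 0" if "B \<in> R" "B \<subseteq> A - Y" for B
  proof -
    have "0 \<le> - \<nu> B"
      using that Y(4)[of B] by (intro m.nonneg_of_sup_charge_le) (auto intro: in_sets)
    then show ?thesis by simp
  qed
  ultimately show ?thesis using Y(1,2) by blast
qed

text \<open>As \<open>R\<close> need not contain the whole space, local Hahn sets of a disjointed
  cover are glued, and signs are added up piece by piece.\<close>

lemma hahn_decomposition:
  assumes W: "\<And>n::nat. W n \<in> R" "(\<Union>n. W n) = space M"
  obtains P where "P \<in> sets M" "\<And>B. B \<in> R \<Longrightarrow> B \<subseteq> P \<Longrightarrow> 0 \<le> \<nu> B"
    "\<And>B. B \<in> R \<Longrightarrow> B \<subseteq> space M - P \<Longrightarrow> \<nu> B \<le> 0"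
proof -
  have WM: "range W \<subseteq> sets M" using W in_sets by auto
  let ?D = "disjointed W"
  have DM: "range ?D \<subseteq> sets M" using sets.range_disjointed_sets[OF WM] .
  have DR: "?D n \<in> R" for n
    using hered[OF W(1)[of n]] DM disjointed_subset[of W n] by auto
  have DU: "(\<Union>n. ?D n) = space M" using W by (simp add: UN_disjointed_eq)
  obtain Y where Y: "\<And>n. Y n \<in> sets M" "\<And>n. Y n \<subseteq> ?D n"
    "\<And>n B. B \<in> R \<Longrightarrow> B \<subseteq> Y n \<Longrightarrow> 0 \<le> \<nu> B" "\<And>n B. B \<in> R \<Longrightarrow> B \<subseteq> ?D n - Y n \<Longrightarrow> \<nu> B \<le> 0"
    using hahn_on[OF DR] by metis
  show thesis
  proof (rule that[of "\<Union>n. Y n"])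
    show YM: "(\<Union>n. Y n) \<in> sets M" using Y by auto
    have nusums: "(\<lambda>n. \<nu> (B \<inter> ?D n)) sums \<nu> B" if "B \<in> R" for B
      using that DM DU sets.sets_into_space[OF in_sets[OF that]]
      by (intro sums_Int) (auto simp: disjoint_family_disjointed)
    have BD: "B \<inter> ?D n \<in> R" if "B \<in> R" for B n
      using that DM by (intro Int_R) auto
    show "0 \<le> \<nu> B" if B: "B \<in> R" "B \<subseteq> (\<Union>n. Y n)" for B
    proof (rule sums_le[OF _ sums_zero nusums[OF B(1)]])
      fix n
      \<comment> \<open>Each \<open>Y k\<close> lies in its own disjoint piece, so within
        \<open>?D n\<close> the set \<open>B\<close> can meet only \<open>Y n\<close>.\<close>
      have "B \<inter> ?D n \<subseteq> Y n"
      proof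
        fix x assume x: "x \<in> B \<inter> ?D n"
        then obtain k where "x \<in> Y k" using B by auto
        moreover from this have "k = n"
          using x Y(2)[of k] disjoint_family_disjointed[of W] by (auto simp: disjoint_family_on_def)
        ultimately show "x \<in> Y n" by simp
      qed
      then show "0 \<le> \<nu> (B \<inter> ?D n)" by (rule Y(3)[OF BD[OF B(1)]])
    qed
    show "\<nu> B \<le> 0" if "B \<in> R" "B \<subseteq> space M - (\<Union>n. Y n)" for B
      by (rule sums_le[OF _ nusums[OF that(1)] sums_zero], rule Y(4)[OF BD[OF that(1)]]) (use that in auto)
  qed
qed

text \<open>On a positive set \<open>\<nu>\<close> is monotone, so the supremum is attained at
  \<open>A\<close> itself.\<close>

lemma sup_charge_positive_set:
  assumes "P \<in> sets M" "\<And>B. B \<in> R \<Longrightarrow> B \<subseteq> P \<Longrightarrow> 0 \<le> \<nu> B" "A \<in> R" "A \<subseteq> P"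
  shows "sup_charge R \<nu> A = ennreal (\<nu> A)"
proof (rule antisym[OF sup_charge_least sup_charge_upper])
  fix B assume B: "B \<in> R" "B \<subseteq> A"
  then have "\<nu> (A - B) = \<nu> A - \<nu> B" using assms by (simp add: nu_Diff)
  moreover have "0 \<le> \<nu> (A - B)" using assms B by (intro assms(2)) (auto intro: Diff_R in_sets)
  ultimately show "ennreal (\<nu> B) \<le> ennreal (\<nu> A)" by (intro ennreal_leI) simp
qed (use assms in auto)

lemma sup_charge_negative_set:
  assumes "\<And>B. B \<in> R \<Longrightarrow> B \<subseteq> N \<Longrightarrow> \<nu> B \<le> 0"
  shows "sup_charge R \<nu> N = 0"
proof -
  have "sup_charge R \<nu> N \<le> 0"
    using assms by (intro sup_charge_least) (auto simp: ennreal_neg)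
  then show ?thesis by simp
qed

end

subsection \<open>Integral representation of order continuous functionals\<close>

lemma ae_wrt_everywhere: "{} \<in> N \<Longrightarrow> (\<And>x. x \<in> space M \<Longrightarrow> Q x) \<Longrightarrow> ae_wrt M N Q"
  unfolding ae_wrt_def by (rule bexI[of _ "{}"]) auto

lemma order_w_contD:
  assumes "order_w_cont M N Y T" "\<And>n. fs n \<in> Y" "f \<in> Y"
    and "ae_wrt M N (\<lambda>x. \<forall>n. 0 \<le> fs n x \<and> fs n x \<le> fs (Suc n) x \<and> (\<lambda>n. fs n x) \<longlonglongrightarrow> f x)"
    and "bounded_linear (xs :: 'e::real_normed_vector \<Rightarrow> real)"
  shows "(\<lambda>n. xs (T (fs n))) \<longlonglongrightarrow> xs (T f)"
  using assms unfolding order_w_cont_def by blast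

lemma ideal_fs_measurable: "ideal_fs M N Y \<Longrightarrow> f \<in> Y \<Longrightarrow> f \<in> borel_measurable M"
  by (auto simp: ideal_fs_def)

lemma ideal_fs_zero: "ideal_fs M N Y \<Longrightarrow> (\<lambda>x. 0) \<in> Y"
  by (simp add: ideal_fs_def)

lemma ideal_fs_add: "ideal_fs M N Y \<Longrightarrow> f \<in> Y \<Longrightarrow> g \<in> Y \<Longrightarrow> (\<lambda>x. f x + g x) \<in> Y"
  by (simp add: ideal_fs_def)

lemma ideal_fs_scale: "ideal_fs M N Y \<Longrightarrow> f \<in> Y \<Longrightarrow> (\<lambda>x. c * f x) \<in> Y"
  by (simp add: ideal_fs_def)

lemma ideal_fs_le:
  assumes "ideal_fs M N Y" "{} \<in> N" "f \<in> Y" "g \<in> borel_measurable M"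
    and "\<And>x. x \<in> space M \<Longrightarrow> \<bar>g x\<bar> \<le> \<bar>f x\<bar>"
  shows "g \<in> Y"
  using assms ae_wrt_everywhere[of N M "\<lambda>x. \<bar>g x\<bar> \<le> \<bar>f x\<bar>"] unfolding ideal_fs_def by blast

lemma (in charge) integrable_posv_negv:
  fixes f :: "'a \<Rightarrow> real"
  assumes "integrable (var_meas M R \<nu>) f"
  shows "integrable (posv_meas M R \<nu>) f" "integrable (negv_meas M R \<nu>) f"
proof -
  have f: "f \<in> borel_measurable M"
    using borel_measurable_integrable[OF assms] by simp
  then have "(\<integral>\<^sup>+x. ennreal (norm (f x)) \<partial>var_meas M R \<nu>)
    = (\<integral>\<^sup>+x. ennreal (norm (f x)) \<partial>posv_meas M R \<nu>) + (\<integral>\<^sup>+x. ennreal (norm (f x)) \<partial>negv_meas M R \<nu>)"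
    by (intro nn_integral_var) simp
  then show "integrable (posv_meas M R \<nu>) f" "integrable (negv_meas M R \<nu>) f"
    using assms f unfolding integrable_iff_bounded by (auto simp: negv_meas_eq)
qed

text \<open>Meant for \<open>R\<close> the delta-ring of \<open>X\<close>, \<open>Y\<close> the
  space \<open>Z\<close> and \<open>\<phi>\<close> a functional composed with \<open>S\<close>.
  \<open>R\<close> may be smaller than the family of sets with indicator in \<open>Y\<close>, but
  countably many of its members cover the space.\<close>

locale represented_functional = charge M R \<nu>
  for M :: "'a measure" and R and \<nu> :: "'a set \<Rightarrow> real" +
  fixes N :: "'a set set" and Y :: "('a \<Rightarrow> real) set" and \<phi> :: "('a \<Rightarrow> real) \<Rightarrow> real"
  assumes ideal: "ideal_fs M N Y" and N_empty: "{} \<in> N"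
    and lin: "linear_op M N Y \<phi>"
    and cont: "order_w_cont M N Y \<phi>"
    and indicator_mem: "B \<in> R \<Longrightarrow> indicator B \<in> Y"
    and nu_eq: "B \<in> R \<Longrightarrow> \<nu> B = \<phi> (indicator B)"
    and cover: "\<exists>W :: nat \<Rightarrow> 'a set. (\<forall>n. W n \<in> R) \<and> (\<Union>n. W n) = space M"
begin

lemma mem_measurable [measurable_dest]: "f \<in> Y \<Longrightarrow> f \<in> borel_measurable M"
  using ideal by (rule ideal_fs_measurable)

lemmas mem_le = ideal_fs_le[OF ideal N_empty]

lemma mem_indicator: "f \<in> Y \<Longrightarrow> A \<in> sets M \<Longrightarrow> (\<lambda>x. f x * indicator A x) \<in> Y"
  by (rule mem_le[of f]) (auto simp: mem_measurable split: split_indicator)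

lemma phi_add: "f \<in> Y \<Longrightarrow> g \<in> Y \<Longrightarrow> \<phi> (\<lambda>x. f x + g x) = \<phi> f + \<phi> g"
  using lin by (simp add: linear_op_def)

lemma phi_scale: "f \<in> Y \<Longrightarrow> \<phi> (\<lambda>x. c * f x) = c * \<phi> f"
  using lin by (simp add: linear_op_def)

lemma phi_zero: "\<phi> (\<lambda>x. 0) = 0"
  using phi_scale[of "\<lambda>x. 0" 0] ideal_fs_zero[OF ideal] by simp

lemma phi_cong: "f \<in> Y \<Longrightarrow> g \<in> Y \<Longrightarrow> (\<And>x. x \<in> space M \<Longrightarrow> f x = g x) \<Longrightarrow> \<phi> f = \<phi> g"
  using lin ae_wrt_everywhere[OF N_empty, of M "\<lambda>x. f x = g x"]
  by (auto simp: linear_op_def class_op_def)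

lemma phi_LIMSEQ:
  assumes "\<And>n. h n \<in> Y" "u \<in> Y"
    and "\<And>n x. 0 \<le> h n x" "\<And>n x. h n x \<le> h (Suc n) x" "\<And>x. (\<lambda>n. h n x) \<longlonglongrightarrow> u x"
  shows "(\<lambda>n. \<phi> (h n)) \<longlonglongrightarrow> \<phi> u"
proof -
  have "ae_wrt M N (\<lambda>x. \<forall>n. 0 \<le> h n x \<and> h n x \<le> h (Suc n) x \<and> (\<lambda>n. h n x) \<longlonglongrightarrow> u x)"
    using assms by (intro ae_wrt_everywhere N_empty) auto
  then show ?thesis
    by (rule order_w_contD[OF cont assms(1,2) _ bounded_linear_ident])
qed

text \<open>Exchanges the two variations, so that results about the positive one carry over to the
  negative one.\<close>

lemma uminus_represented: "represented_functional M R (\<lambda>B. - \<nu> B) N Y (\<lambda>f. - \<phi> f)"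
proof (intro represented_functional.intro uminus_charge represented_functional_axioms.intro
    ideal N_empty indicator_mem cover)
  show "linear_op M N Y (\<lambda>f. - \<phi> f)"
    using lin by (simp add: linear_op_def class_op_def)
  show "order_w_cont M N Y (\<lambda>f. - \<phi> f)"
    unfolding order_w_cont_def
    using order_w_contD[OF cont _ _ _ bounded_linear_compose[OF _ bounded_linear_minus[OF bounded_linear_ident]]]
    by auto
  show "- \<nu> B = - \<phi> (indicator B)" if "B \<in> R" for B
    using nu_eq[OF that] by (rule arg_cong)
qed

text \<open>Since \<open>ennreal\<close> sends negative numbers to 0, the equation alone would admit
  a negative \<open>\<phi> h\<close> with zero integral; the sign condition excludes this.\<close>

definition represents :: "('a \<Rightarrow> real) \<Rightarrow> bool" where
  "represents h \<longleftrightarrow> 0 \<le> \<phi> h \<and> ennreal (\<phi> h) = (\<integral>\<^sup>+x. ennreal (h x) \<partial>posv_meas M R \<nu>)"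

text \<open>Order continuity carries \<open>\<phi>\<close> to the limit and monotone convergence
  carries the integral, so the two limits coincide.\<close>

lemma represents_limit:
  assumes "\<And>n. h n \<in> Y" "u \<in> Y"
    and "\<And>n x. 0 \<le> h n x" "\<And>n x. h n x \<le> h (Suc n) x" "\<And>x. (\<lambda>n. h n x) \<longlonglongrightarrow> u x"
    and "\<And>n. represents (h n)"
  shows "represents u"
proof -
  have lim: "(\<lambda>n. \<phi> (h n)) \<longlonglongrightarrow> \<phi> u"
    by (rule phi_LIMSEQ) (fact assms)+
  have "(\<lambda>n. \<integral>\<^sup>+x. ennreal (h n x) \<partial>posv_meas M R \<nu>) \<longlonglongrightarrow> (\<integral>\<^sup>+x. ennreal (u x) \<partial>posv_meas M R \<nu>)"
  proof (rule nn_integral_LIMSEQ)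
    show "incseq (\<lambda>n x. ennreal (h n x))"
      using assms(4) by (intro incseq_SucI le_funI ennreal_leI)
    show "(\<lambda>x. ennreal (h n x)) \<in> borel_measurable (posv_meas M R \<nu>)" for n
      using mem_measurable[OF assms(1)[of n]] by simp
    show "(\<lambda>n. ennreal (h n x)) \<longlonglongrightarrow> ennreal (u x)" for x
      using assms(5) by (intro tendsto_ennrealI)
  qed
  moreover have rep: "(\<integral>\<^sup>+x. ennreal (h n x) \<partial>posv_meas M R \<nu>) = ennreal (\<phi> (h n))" "0 \<le> \<phi> (h n)" for n
    using assms(6)[of n] by (simp_all add: represents_def)
  ultimately have "(\<lambda>n. ennreal (\<phi> (h n))) \<longlonglongrightarrow> (\<integral>\<^sup>+x. ennreal (u x) \<partial>posv_meas M R \<nu>)"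
    by simp
  then have "ennreal (\<phi> u) = (\<integral>\<^sup>+x. ennreal (u x) \<partial>posv_meas M R \<nu>)"
    by (rule LIMSEQ_unique[OF tendsto_ennrealI[OF lim]])
  moreover have "0 \<le> \<phi> u"
    by (rule LIMSEQ_le_const[OF lim]) (use rep(2) in auto)
  ultimately show ?thesis by (simp add: represents_def)
qed

text \<open>Membership in \<open>Y\<close> sits inside the conclusion as an implication because the
  functions built by the induction are not known to lie in \<open>Y\<close>; the inductive cases
  pass it from the compound function to its parts, by scaling or the ideal property.\<close>

lemma represents_on_ring_set:
  assumes P: "P \<in> sets M" "\<And>B. B \<in> R \<Longrightarrow> B \<subseteq> P \<Longrightarrow> 0 \<le> \<nu> B"
    and W: "W \<in> R" "W \<subseteq> P"
    and u: "u \<in> borel_measurable M" "\<And>x. 0 \<le> u x"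
  shows "(\<lambda>x. u x * indicator W x) \<in> Y \<longrightarrow> represents (\<lambda>x. u x * indicator W x)"
  using u
proof (induction rule: borel_measurable_induct_real)
  case (set A)
  have eq: "(\<lambda>x. indicator A x * indicator W x :: real) = indicator (W \<inter> A)"
    by (auto split: split_indicator)
  have WA: "W \<inter> A \<in> R" "W \<inter> A \<subseteq> P" using W set by (auto intro: Int_R)
  have "(\<integral>\<^sup>+x. ennreal (indicator (W \<inter> A) x) \<partial>posv_meas M R \<nu>) = emeasure (posv_meas M R \<nu>) (W \<inter> A)"
    using WA by (subst nn_integral_indicator[symmetric]) (auto simp: in_sets ennreal_indicator)
  also have "\<dots> = ennreal (\<nu> (W \<inter> A))"
    using WA P by (simp add: emeasure_posv in_sets sup_charge_positive_set)
  finally show ?case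
    unfolding eq represents_def using P(2)[OF WA] nu_eq[OF WA(1)] by auto
next
  case (mult u c)
  show ?case
  proof
    assume cu: "(\<lambda>x. c * u x * indicator W x) \<in> Y"
    show "represents (\<lambda>x. c * u x * indicator W x)"
    \<comment> \<open>For \<open>c = 0\<close> nothing can be inferred about \<open>u\<close>, but
      both sides are 0.\<close>
    proof (cases "c = 0")
      case True
      then show ?thesis by (simp add: represents_def phi_zero)
    next
      case False
      have uY: "(\<lambda>x. u x * indicator W x) \<in> Y"
        using ideal_fs_scale[OF ideal cu, of "1 / c"] False by (simp add: mult.assoc)
      then have rep: "represents (\<lambda>x. u x * indicator W x)" using mult by blast
      have "(\<integral>\<^sup>+x. ennreal (c * (u x * indicator W x)) \<partial>posv_meas M R \<nu>)
        = (\<integral>\<^sup>+x. ennreal c * ennreal (u x * indicator W x) \<partial>posv_meas M R \<nu>)"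
        using mult by (intro nn_integral_cong ennreal_mult) auto
      also have "\<dots> = ennreal c * (\<integral>\<^sup>+x. ennreal (u x * indicator W x) \<partial>posv_meas M R \<nu>)"
        using mem_measurable[OF uY] by (intro nn_integral_cmult) simp
      finally show ?thesis
        using rep mult(1) phi_scale[OF uY, of c]
        by (simp add: represents_def mult.assoc ennreal_mult)
    qed
  qed
next
  case (add u v)
  show ?case
  proof
    assume s: "(\<lambda>x. (v x + u x) * indicator W x) \<in> Y"
    have Y: "(\<lambda>x. w x * indicator W x) \<in> Y"
      if "w \<in> borel_measurable M" "\<And>x. 0 \<le> w x" "\<And>x. w x \<le> v x + u x" for w
    proof (rule mem_le[OF s])
      show "(\<lambda>x. w x * indicator W x) \<in> borel_measurable M"
        using that(1) in_sets[OF W(1)] by simp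
      show "\<bar>w x * indicator W x\<bar> \<le> \<bar>(v x + u x) * indicator W x\<bar>" for x
        using that(2,3)[of x] by (simp add: abs_mult mult_right_mono)
    qed
    have Y: "(\<lambda>x. u x * indicator W x) \<in> Y" "(\<lambda>x. v x * indicator W x) \<in> Y"
      using add.hyps by (simp_all add: Y)
    then have rep: "represents (\<lambda>x. u x * indicator W x)" "represents (\<lambda>x. v x * indicator W x)"
      using add.IH by simp_all
    have "(\<integral>\<^sup>+x. ennreal (v x * indicator W x + u x * indicator W x) \<partial>posv_meas M R \<nu>)
      = (\<integral>\<^sup>+x. ennreal (v x * indicator W x) + ennreal (u x * indicator W x) \<partial>posv_meas M R \<nu>)"
      using add by (intro nn_integral_cong ennreal_plus) auto
    also have "\<dots> = (\<integral>\<^sup>+x. ennreal (v x * indicator W x) \<partial>posv_meas M R \<nu>)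
      + (\<integral>\<^sup>+x. ennreal (u x * indicator W x) \<partial>posv_meas M R \<nu>)"
      using Y[THEN mem_measurable] by (intro nn_integral_add) simp_all
    finally show "represents (\<lambda>x. (v x + u x) * indicator W x)"
      using rep phi_add[OF Y(2,1)]
      by (simp add: represents_def distrib_right)
  qed
next
  case (seq U)
  show ?case
  proof
    assume uY: "(\<lambda>x. u x * indicator W x) \<in> Y"
    \<comment> \<open>Pointwise convergence is given on \<open>space M\<close> only; outside it
      \<open>indicator W\<close> vanishes.\<close>
    have Wsp: "W \<subseteq> space M" using sets.sets_into_space[OF in_sets[OF W(1)]] .
    have mono: "U i x \<le> U (Suc i) x" for i x
      using seq.hyps(3) by (simp add: incseq_Suc_iff le_fun_def)
    have le: "U i x \<le> u x" if "x \<in> space M" for i x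
      by (rule incseq_le[OF incseq_SucI seq.hyps(4)[OF that]]) (rule mono)
    have UY: "(\<lambda>x. U i x * indicator W x) \<in> Y" for i
    proof (rule mem_le[OF uY])
      show "(\<lambda>x. U i x * indicator W x) \<in> borel_measurable M"
        using seq.hyps(1) in_sets[OF W(1)] by simp
      show "\<bar>U i x * indicator W x\<bar> \<le> \<bar>u x * indicator W x\<bar>" if "x \<in> space M" for x
        using le[OF that, of i] seq.hyps(2)[of i x] by (simp add: abs_mult mult_right_mono)
    qed
    show "represents (\<lambda>x. u x * indicator W x)"
    proof (rule represents_limit[OF UY uY])
      show "(\<lambda>i. U i x * indicator W x) \<longlonglongrightarrow> u x * indicator W x" for x
        using seq.hyps(4)[of x] Wsp by (auto split: split_indicator)
      show "represents (\<lambda>x. U i x * indicator W x)" for i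
        using seq.IH UY by blast
    qed (use seq.hyps(2) mono in \<open>auto split: split_indicator\<close>)
  qed
qed

text \<open>The value of \<open>\<phi>\<close> at \<open>g\<close> cut off to \<open>P\<close> is a
  real number from the start; reaching it as an increasing limit over ring sets identifies the
  integral and proves it finite.\<close>

lemma represents_on_positive_set:
  assumes P: "P \<in> sets M" "\<And>B. B \<in> R \<Longrightarrow> B \<subseteq> P \<Longrightarrow> 0 \<le> \<nu> B"
    and g: "g \<in> Y" "\<And>x. 0 \<le> g x"
  shows "represents (\<lambda>x. g x * indicator P x)"
proof -
  obtain W where W: "\<And>n::nat. W n \<in> R" "(\<Union>n. W n) = space M" using cover by auto
  \<comment> \<open>Finite unions of the cover, cut down to \<open>P\<close>, stay in the ring and
    increase to \<open>P\<close>.\<close>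
  define V where "V n = (\<Union>i\<le>n. W i) \<inter> P" for n
  have "(\<Union>i\<le>n. W i) \<in> R" for n
    by (induction n) (auto simp: W atMost_Suc intro!: Un_R)
  then have V: "V n \<in> R" "V n \<subseteq> P" for n
    unfolding V_def using P by (auto intro: Int_R)
  have VY: "(\<lambda>x. g x * indicator (V n) x) \<in> Y" for n
    using g V by (intro mem_indicator) (auto intro: in_sets)
  show ?thesis
  proof (rule represents_limit[OF VY mem_indicator[OF g(1) P(1)]])
    show "represents (\<lambda>x. g x * indicator (V n) x)" for n
      using represents_on_ring_set[OF P V(1) V(2) mem_measurable[OF g(1)] g(2)] VY by blast
    show "(\<lambda>n. g x * indicator (V n) x) \<longlonglongrightarrow> g x * indicator P x" for x
    proof (cases "x \<in> P")
      case True
      then obtain k where "x \<in> W k" using W(2) sets.sets_into_space[OF P(1)] by blast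
      then have "x \<in> V n" if "k \<le> n" for n using True that by (auto simp: V_def)
      then have "eventually (\<lambda>n. g x * indicator (V n) x = g x * indicator P x) sequentially"
        using True by (intro eventually_sequentiallyI[of k]) auto
      then show ?thesis by (rule tendsto_eventually)
    qed (simp add: V_def)
    show "g x * indicator (V n) x \<le> g x * indicator (V (Suc n)) x" for n x
      using g by (auto simp: V_def split: split_indicator)
  qed (use g in auto)
qed

text \<open>The complement of \<open>P\<close> is null for the positive variation, so cutting
  \<open>g\<close> off to \<open>P\<close> leaves its integral unchanged.\<close>

lemma posv_integral:
  assumes P: "P \<in> sets M" "\<And>B. B \<in> R \<Longrightarrow> B \<subseteq> P \<Longrightarrow> 0 \<le> \<nu> B"
    "\<And>B. B \<in> R \<Longrightarrow> B \<subseteq> space M - P \<Longrightarrow> \<nu> B \<le> 0"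
    and g: "g \<in> Y" "\<And>x. 0 \<le> g x"
  shows "integrable (posv_meas M R \<nu>) g"
    "integral\<^sup>L (posv_meas M R \<nu>) g = \<phi> (\<lambda>x. g x * indicator P x)"
proof -
  have "emeasure (posv_meas M R \<nu>) (space M - P) = 0"
    using P by (simp add: emeasure_posv sup_charge_negative_set)
  then have "AE x in posv_meas M R \<nu>. x \<in> P"
    using P by (intro AE_I[of _ _ "space M - P"]) auto
  then have "(\<integral>\<^sup>+x. ennreal (g x) \<partial>posv_meas M R \<nu>)
    = (\<integral>\<^sup>+x. ennreal (g x * indicator P x) \<partial>posv_meas M R \<nu>)"
    by (intro nn_integral_cong_AE) auto
  then have "has_bochner_integral (posv_meas M R \<nu>) g (\<phi> (\<lambda>x. g x * indicator P x))"
    using represents_on_positive_set[OF P(1,2) g] g mem_measurable[OF g(1)] unfolding represents_def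
    by (intro has_bochner_integral_nn_integral) auto
  then show "integrable (posv_meas M R \<nu>) g"
    "integral\<^sup>L (posv_meas M R \<nu>) g = \<phi> (\<lambda>x. g x * indicator P x)"
    by (auto simp: has_bochner_integral_iff)
qed

lemma nonneg_representation:
  assumes g: "g \<in> Y" "\<And>x. 0 \<le> g x"
  shows "integrable (posv_meas M R \<nu>) g" "integrable (negv_meas M R \<nu>) g"
    "integral\<^sup>L (posv_meas M R \<nu>) g - integral\<^sup>L (negv_meas M R \<nu>) g = \<phi> g"
proof -
  interpret m: represented_functional M R "\<lambda>B. - \<nu> B" N Y "\<lambda>f. - \<phi> f"
    by (rule uminus_represented)
  obtain W where W: "\<And>n::nat. W n \<in> R" "(\<Union>n. W n) = space M" using cover by auto
  obtain P where P: "P \<in> sets M" "\<And>B. B \<in> R \<Longrightarrow> B \<subseteq> P \<Longrightarrow> 0 \<le> \<nu> B"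
    "\<And>B. B \<in> R \<Longrightarrow> B \<subseteq> space M - P \<Longrightarrow> \<nu> B \<le> 0"
    using hahn_decomposition[OF W] by blast
  have Psp: "space M - (space M - P) = P" using sets.sets_into_space[OF P(1)] by auto
  note pos = posv_integral[OF P g]
  \<comment> \<open>The complement of \<open>P\<close> is a positive set for \<open>- \<nu>\<close>,
    which gives the negative variation through the interpretation \<open>m\<close>.\<close>
  have Q: "space M - P \<in> sets M" "\<And>B. B \<in> R \<Longrightarrow> B \<subseteq> space M - P \<Longrightarrow> 0 \<le> - \<nu> B"
    "\<And>B. B \<in> R \<Longrightarrow> B \<subseteq> space M - (space M - P) \<Longrightarrow> - \<nu> B \<le> 0"
    unfolding neg_0_le_iff_le neg_le_0_iff_le Psp by (rule sets.compl_sets P | assumption)+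
  have neg: "integrable (negv_meas M R \<nu>) g"
    "integral\<^sup>L (negv_meas M R \<nu>) g = - \<phi> (\<lambda>x. g x * indicator (space M - P) x)"
    using m.posv_integral[OF Q g] by (simp_all add: negv_meas_eq)
  show "integrable (posv_meas M R \<nu>) g" "integrable (negv_meas M R \<nu>) g"
    using pos(1) neg(1) by simp_all
  have Y: "(\<lambda>x. g x * indicator P x) \<in> Y" "(\<lambda>x. g x * indicator (space M - P) x) \<in> Y"
    using P g by (auto intro!: mem_indicator)
  \<comment> \<open>The two functions agree on \<open>space M\<close> only, hence
    \<open>phi_cong\<close> instead of rewriting.\<close>
  have "\<phi> g = \<phi> (\<lambda>x. g x * indicator P x + g x * indicator (space M - P) x)"
    using g Y by (intro phi_cong ideal_fs_add[OF ideal]) (auto split: split_indicator)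
  also have "\<dots> = \<phi> (\<lambda>x. g x * indicator P x) + \<phi> (\<lambda>x. g x * indicator (space M - P) x)"
    using Y by (rule phi_add)
  finally show "integral\<^sup>L (posv_meas M R \<nu>) g - integral\<^sup>L (negv_meas M R \<nu>) g = \<phi> g"
    using pos neg by simp
qed

lemma representation:
  assumes f: "f \<in> Y"
  shows "integrable (posv_meas M R \<nu>) f" "integrable (negv_meas M R \<nu>) f"
    "integral\<^sup>L (posv_meas M R \<nu>) f - integral\<^sup>L (negv_meas M R \<nu>) f = \<phi> f"
proof -
  let ?p = "\<lambda>x. max 0 (f x)" and ?n = "\<lambda>x. max 0 (- f x)"
  have Y: "?p \<in> Y" "?n \<in> Y"
    using mem_measurable[OF f] by (auto intro!: mem_le[OF f])
  have f_eq: "f = (\<lambda>x. ?p x + (- 1) * ?n x)" by (auto simp: max_def)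
  note p = nonneg_representation[OF Y(1), simplified]
  note n = nonneg_representation[OF Y(2), simplified]
  show "integrable (posv_meas M R \<nu>) f" "integrable (negv_meas M R \<nu>) f"
    by (subst f_eq; use p n in simp)+
  have "integral\<^sup>L L f = integral\<^sup>L L ?p - integral\<^sup>L L ?n"
    if "integrable L ?p" "integrable L ?n" for L
    using that by (subst f_eq) simp
  moreover have "\<phi> f = \<phi> ?p - \<phi> ?n"
    using phi_add[OF Y(1) ideal_fs_scale[OF ideal Y(2), of "- 1"]] phi_scale[OF Y(2), of "- 1"] f_eq
    by simp
  ultimately show "integral\<^sup>L (posv_meas M R \<nu>) f - integral\<^sup>L (negv_meas M R \<nu>) f = \<phi> f"
    using p n by simp
qed

lemma integrable_var:
  assumes f: "f \<in> Y"
  shows "integrable (var_meas M R \<nu>) f"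
proof -
  have m: "f \<in> borel_measurable M" using f by (rule mem_measurable)
  have "(\<integral>\<^sup>+x. ennreal (norm (f x)) \<partial>var_meas M R \<nu>)
    = (\<integral>\<^sup>+x. ennreal (norm (f x)) \<partial>posv_meas M R \<nu>) + (\<integral>\<^sup>+x. ennreal (norm (f x)) \<partial>negv_meas M R \<nu>)"
    using m by (intro nn_integral_var) simp
  also have "\<dots> < \<infinity>"
    using representation(1,2)[OF f] by (simp add: integrable_iff_bounded)
  finally show ?thesis using m by (simp add: integrable_iff_bounded)
qed

lemma sint_eq:
  assumes "f \<in> Y" "A \<in> sets M"
  shows "sint M R \<nu> A f = \<phi> (\<lambda>x. f x * indicator A x)"
  using representation(3)[OF mem_indicator[OF assms]] by (simp add: sint_def mult.commute)

lemma sint_space: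
  assumes "f \<in> Y"
  shows "sint M R \<nu> (space M) f = \<phi> f"
  unfolding sint_eq[OF assms sets.top]
  by (rule phi_cong) (auto intro: mem_indicator assms)

end

subsection \<open>Factorization through the vector measure\<close>

lemma class_opD:
  "class_op M N Y T \<Longrightarrow> f \<in> Y \<Longrightarrow> g \<in> Y \<Longrightarrow> ae_wrt M N (\<lambda>x. f x = g x) \<Longrightarrow> T f = T g"
  by (simp add: class_op_def)

lemma linear_op_scale: "linear_op M N Y T \<Longrightarrow> f \<in> Y \<Longrightarrow> T (\<lambda>x. c * f x) = c *\<^sub>R T f"
  by (simp add: linear_op_def)

lemma linear_op_compose:
  fixes xs :: "'e::real_normed_vector \<Rightarrow> real"
  assumes "linear_op M N Y T" "bounded_linear xs"
  shows "linear_op M N Y (\<lambda>f. xs (T f))"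
proof -
  interpret bounded_linear xs by (rule assms(2))
  show ?thesis using assms(1) by (simp add: linear_op_def class_op_def add scale)
qed

lemma order_w_cont_compose:
  fixes xs :: "'e::real_normed_vector \<Rightarrow> real"
  assumes "order_w_cont M N Y T" "bounded_linear xs"
  shows "order_w_cont M N Y (\<lambda>f. xs (T f))"
  unfolding order_w_cont_def
  using order_w_contD[OF assms(1) _ _ _ bounded_linear_compose[OF _ assms(2)]] by auto

text \<open>The ring properties come from \<open>X\<close> being an ideal, finite additivity from
  linearity. Indicators of partial unions increase to that of the whole union, so order continuity
  gives countable additivity.\<close>

lemma charge_of_functional:
  fixes \<phi> :: "('a \<Rightarrow> real) \<Rightarrow> real"
  assumes ideal: "ideal_fs M N X" and N: "{} \<in> N"
    and lin: "linear_op M N X \<phi>" and cont: "order_w_cont M N X \<phi>"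
  shows "charge M (delta_ring_of M X) (\<lambda>B. \<phi> (indicator B))"
proof
  let ?R = "delta_ring_of M X"
  note le = ideal_fs_le[OF ideal N]
  have R: "B \<in> ?R \<longleftrightarrow> B \<in> sets M \<and> indicator B \<in> X" for B
    by (auto simp: delta_ring_of_def)
  show "?R \<subseteq> sets M" by (auto simp: R)
  have "indicator {} = (\<lambda>x::'a. 0::real)" by (simp add: fun_eq_iff)
  then show "{} \<in> ?R" using ideal_fs_zero[OF ideal] by (simp add: R)
  show "B \<in> ?R" if "A \<in> ?R" "B \<in> sets M" "B \<subseteq> A" for A B
    using that le[of "indicator A" "indicator B"] by (auto simp: R indicator_def)
  show Un: "A \<union> B \<in> ?R" if "A \<in> ?R" "B \<in> ?R" for A B
  proof -
    have "(\<lambda>x. indicator A x + indicator B x :: real) \<in> X"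
      using that by (intro ideal_fs_add[OF ideal]) (auto simp: R)
    then show ?thesis using that
      by (auto simp: R intro!: le[of "\<lambda>x. indicator A x + indicator B x"] split: split_indicator)
  qed
  have phi_add: "\<phi> (\<lambda>x. f x + g x) = \<phi> f + \<phi> g" if "f \<in> X" "g \<in> X" for f g
    using lin that by (simp add: linear_op_def)
  have phi0: "\<phi> (\<lambda>x. 0) = 0"
    using phi_add[of "\<lambda>x. 0" "\<lambda>x. 0"] ideal_fs_zero[OF ideal] by simp
  fix D :: "nat \<Rightarrow> 'a set"
  assume D: "range D \<subseteq> ?R" "disjoint_family D" "(\<Union>i. D i) \<in> ?R"
  define U where "U n = (\<Union>i<n. D i)" for n
  have U: "U n \<in> ?R \<and> \<phi> (indicator (U n)) = (\<Sum>i<n. \<phi> (indicator (D i)))" for n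
  proof (induction n)
    case 0
    then show ?case using \<open>{} \<in> ?R\<close> \<open>indicator {} = _\<close> phi0 by (simp add: U_def)
  next
    case (Suc n)
    have Dn: "D n \<in> ?R" using D(1) by auto
    have eq: "U (Suc n) = U n \<union> D n" by (auto simp: U_def lessThan_Suc)
    have "U n \<inter> D n = {}"
      using disjoint_family_onD[OF D(2) UNIV_I UNIV_I less_imp_neq, of _ n] by (auto simp: U_def)
    then have "indicator (U n \<union> D n) = (\<lambda>x. indicator (U n) x + indicator (D n) x :: real)"
      by (auto simp: indicator_def fun_eq_iff)
    then have "\<phi> (indicator (U n \<union> D n)) = \<phi> (indicator (U n)) + \<phi> (indicator (D n))"
      using Suc Dn by (simp add: phi_add R)
    then show ?case using Suc Un[of "U n" "D n"] Dn by (simp add: eq)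
  qed
  have "ae_wrt M N (\<lambda>x. \<forall>n. 0 \<le> (indicator (U n) x :: real) \<and> (indicator (U n) x :: real) \<le> indicator (U (Suc n)) x
      \<and> (\<lambda>n. indicator (U n) x :: real) \<longlonglongrightarrow> indicator (\<Union>i. D i) x)"
  proof (intro ae_wrt_everywhere N allI conjI)
    fix x n
    show "(indicator (U n) x :: real) \<le> indicator (U (Suc n)) x"
      by (auto simp: U_def lessThan_Suc split: split_indicator)
    show "(\<lambda>n. indicator (U n) x :: real) \<longlonglongrightarrow> indicator (\<Union>i. D i) x"
      unfolding U_def by (rule LIMSEQ_indicator_UN)
  qed simp
  then have "(\<lambda>n. \<phi> (indicator (U n))) \<longlonglongrightarrow> \<phi> (indicator (\<Union>i. D i))"
    using U D(3) by (intro order_w_contD[OF cont _ _ _ bounded_linear_ident]) (auto simp: R)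
  then show "(\<lambda>i. \<phi> (indicator (D i))) sums \<phi> (indicator (\<Union>i. D i))"
    using U by (simp add: sums_def)
qed

text \<open>\<open>vm_I\<close> is a definite description; its uniqueness is the separation of
  points by functionals.\<close>

lemma vm_I_eqI:
  fixes v :: "'e::real_normed_vector"
  assumes v: "\<And>xs :: 'e \<Rightarrow> real. bounded_linear xs \<Longrightarrow> xs v = sint M R (xs \<circ> m) (space M) f"
  shows "vm_I M R m f = v"
  unfolding vm_I_def
proof (rule the_equality)
  fix w assume w: "\<forall>xs :: 'e \<Rightarrow> real. bounded_linear xs \<longrightarrow> xs w = sint M R (xs \<circ> m) (space M) f"
  show "w = v"
  proof (rule functionals_separate)
    fix xs :: "'e \<Rightarrow> real" assume "bounded_linear xs"
    then show "xs w = xs v" using v[of xs] w[rule_format, of xs] by argo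
  qed
qed (intro allI impI v)

lemma vm_I_sint:
  fixes m :: "'a set \<Rightarrow> 'e::real_normed_vector"
  assumes f: "f \<in> vm_L1 M R m" and xs: "bounded_linear xs"
  shows "xs (vm_I M R m f) = sint M R (xs \<circ> m) (space M) f"
proof -
  have "\<forall>A\<in>sets M. \<exists>v. \<forall>xs :: 'e \<Rightarrow> real. bounded_linear xs \<longrightarrow> xs v = sint M R (xs \<circ> m) A f"
    using f unfolding vm_L1_def mem_Collect_eq by (elim conjE)
  from bspec[OF this sets.top]
  obtain v where "\<forall>xs :: 'e \<Rightarrow> real. bounded_linear xs \<longrightarrow> xs v = sint M R (xs \<circ> m) (space M) f" ..
  then have v: "xs v = sint M R (xs \<circ> m) (space M) f" if "bounded_linear xs" for xs
    using that by (elim allE impE)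
  have eq: "vm_I M R m f = v" by (rule vm_I_eqI) (rule v)
  show ?thesis unfolding eq by (rule v[OF xs])
qed

text \<open>The one-element family \<open>{B}\<close> bounds unit-ball functionals at
  \<open>m B\<close> by the semivariation; scaling and separation of points then give
  \<open>m B = 0\<close>. Conversely all sums in the variations vanish.\<close>

lemma vm_null_iff:
  fixes m :: "'a set \<Rightarrow> 'e::real_normed_vector"
  shows "A \<in> vm_null M R m \<longleftrightarrow> A \<in> sets M \<and> (\<forall>B\<in>R. B \<subseteq> A \<longrightarrow> m B = 0)"
proof (intro iffI conjI ballI impI)
  assume A: "A \<in> vm_null M R m"
  then show "A \<in> sets M" by (simp add: vm_null_def)
  fix B assume B: "B \<in> R" "B \<subseteq> A"
  have unit: "xs (m B) = 0" if "bounded_linear xs" "onorm xs \<le> 1" for xs :: "'e \<Rightarrow> real"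
  proof -
    have "ennreal \<bar>(xs \<circ> m) B\<bar> \<le> var_fn R (xs \<circ> m) A"
      unfolding var_fn_def using B by (intro SUP_upper2[of "{B}"]) auto
    also have "\<dots> \<le> semivar R m A"
      unfolding semivar_def using that by (intro SUP_upper) auto
    also have "\<dots> = 0" using A by (simp add: vm_null_def)
    finally show ?thesis by simp
  qed
  show "m B = 0"
  proof (rule functionals_separate)
    fix xs :: "'e \<Rightarrow> real" assume xs: "bounded_linear xs"
    \<comment> \<open>The added 1 keeps the denominator positive when \<open>onorm xs\<close> is
      0.\<close>
    let ?c = "inverse (onorm xs + 1)"
    have "onorm (\<lambda>x. ?c *\<^sub>R xs x) \<le> 1"
      unfolding onorm_scaleR[OF xs] using onorm_pos_le[OF xs] by (simp add: divide_simps)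
    moreover have "bounded_linear (\<lambda>x. ?c *\<^sub>R xs x)"
      by (rule bounded_linear_compose[OF bounded_linear_scaleR_right xs])
    ultimately have "?c *\<^sub>R xs (m B) = 0"
      using unit[of "\<lambda>x. ?c *\<^sub>R xs x"] by blast
    then have "xs (m B) = 0" using onorm_pos_le[OF xs] by auto
    then show "xs (m B) = xs 0" using linear_0[OF bounded_linear.linear[OF xs]] by simp
  qed
next
  assume A: "A \<in> sets M \<and> (\<forall>B\<in>R. B \<subseteq> A \<longrightarrow> m B = 0)"
  have "var_fn R (xs \<circ> m) A \<le> 0" if "bounded_linear xs" for xs :: "'e \<Rightarrow> real"
    unfolding var_fn_def
  proof (rule SUP_least)
    fix P assume P: "P \<in> {P. finite P \<and> disjoint P \<and> P \<subseteq> R \<and> \<Union>P \<subseteq> A}"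
    have "m B = 0" if "B \<in> P" for B using A P that by blast
    then have "(xs \<circ> m) B = 0" if "B \<in> P" for B
      using that linear_0[OF bounded_linear.linear[OF \<open>bounded_linear xs\<close>]] by simp
    then show "(\<Sum>B\<in>P. ennreal \<bar>(xs \<circ> m) B\<bar>) \<le> 0" by simp
  qed
  then have "semivar R m A \<le> 0"
    unfolding semivar_def by (intro SUP_least) auto
  then show "A \<in> vm_null M R m" using A by (simp add: vm_null_def)
qed

lemma (in charge) AE_posv:
  assumes "A \<in> sets M" "{x \<in> space M. \<not> Q x} \<subseteq> A" "\<And>B. B \<in> R \<Longrightarrow> B \<subseteq> A \<Longrightarrow> \<nu> B = 0"
  shows "AE x in posv_meas M R \<nu>. Q x"
proof (rule AE_I[of _ _ A])
  have "sup_charge R \<nu> A = 0" by (rule sup_charge_negative_set) (simp add: assms(3))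
  then show "emeasure (posv_meas M R \<nu>) A = 0" using assms(1) by (simp add: emeasure_posv)
qed (use assms in simp_all)

text \<open>A null set of \<open>m\<close> is null for both variations of
  \<open>xs \<circ> m\<close>, which turns \<open>ae_wrt\<close> into the \<open>AE\<close> that
  integral lemmas expect.\<close>

lemma AE_of_ae_wrt_vm_null:
  fixes m :: "'a set \<Rightarrow> 'e::real_normed_vector" and xs :: "'e \<Rightarrow> real"
  assumes m: "charge M R (xs \<circ> m)" and xs: "bounded_linear xs" and Q: "ae_wrt M (vm_null M R m) Q"
  shows "AE x in posv_meas M R (xs \<circ> m). Q x" "AE x in negv_meas M R (xs \<circ> m). Q x"
proof -
  obtain A where A: "A \<in> vm_null M R m" "{x \<in> space M. \<not> Q x} \<subseteq> A"
    using Q by (auto simp: ae_wrt_def)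
  have AM: "A \<in> sets M" using A(1) by (simp add: vm_null_iff)
  have zero: "(xs \<circ> m) B = 0" if "B \<in> R" "B \<subseteq> A" for B
    using A(1) that linear_0[OF bounded_linear.linear[OF xs]] by (simp add: vm_null_iff)
  show "AE x in posv_meas M R (xs \<circ> m). Q x"
    by (rule charge.AE_posv[OF m AM A(2) zero])
  show "AE x in negv_meas M R (xs \<circ> m). Q x"
    unfolding negv_meas_eq
    by (rule charge.AE_posv[OF charge.uminus_charge[OF m] AM A(2)]) (simp only: zero minus_zero)
qed

text \<open>Read with \<open>Z = X\<close> and \<open>S = T\<close> this gives the factorization, for general \<open>Z\<close> its optimality.\<close>

lemma represented_of_extension:
  fixes T S :: "('a \<Rightarrow> real) \<Rightarrow> 'e::real_normed_vector"
  assumes X: "ideal_fs M N X" "{} \<in> N" "sigma_property M X" "linear_op M N X T" "order_w_cont M N X T"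
    and Z: "ideal_fs M N' Z" "{} \<in> N'" "linear_op M N' Z S" "order_w_cont M N' Z S"
    and ext: "X \<subseteq> Z" "\<forall>f\<in>X. T f = S f"
    and xs: "bounded_linear xs"
  shows "represented_functional M (delta_ring_of M X) (xs \<circ> vmeas T) N' Z (\<lambda>f. xs (S f))"
proof (intro represented_functional.intro represented_functional_axioms.intro Z(1,2)
    linear_op_compose[OF Z(3) xs] order_w_cont_compose[OF Z(4) xs])
  show "charge M (delta_ring_of M X) (xs \<circ> vmeas T)"
    using charge_of_functional[OF X(1,2) linear_op_compose[OF X(4) xs] order_w_cont_compose[OF X(5) xs]]
    by (simp add: vmeas_def comp_def)
  show "\<exists>W :: nat \<Rightarrow> 'a set. (\<forall>n. W n \<in> delta_ring_of M X) \<and> (\<Union>n. W n) = space M"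
    using X(3) by (auto simp: sigma_property_def delta_ring_of_def)
  show "(xs \<circ> vmeas T) B = xs (S (indicator B))" if "B \<in> delta_ring_of M X" for B
    using that ext by (simp add: vmeas_def delta_ring_of_def)
  show "indicator B \<in> Z" if "B \<in> delta_ring_of M X" for B
    using that ext by (auto simp: delta_ring_of_def)
qed

lemma factorization_of_extension:
  fixes T S :: "('a \<Rightarrow> real) \<Rightarrow> 'e::real_normed_vector"
  assumes X: "ideal_fs M N X" "{} \<in> N" "sigma_property M X" "linear_op M N X T" "order_w_cont M N X T"
    and Z: "ideal_fs M N' Z" "{} \<in> N'" "linear_op M N' Z S" "order_w_cont M N' Z S"
    and ext: "X \<subseteq> Z" "\<forall>f\<in>X. T f = S f"
    and N': "N' \<subseteq> sets M"
  shows "incl_wd N' Z (vm_null M (delta_ring_of M X) (vmeas T)) (vm_L1 M (delta_ring_of M X) (vmeas T))"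
    and "f \<in> Z \<Longrightarrow> S f = vm_I M (delta_ring_of M X) (vmeas T) f"
proof -
  let ?R = "delta_ring_of M X" and ?m = "vmeas T"
  note rep = represented_of_extension[OF assms(1-11)]
  have "A \<in> vm_null M ?R ?m" if "A \<in> N'" for A
  proof -
    have "?m B = 0" if "B \<in> ?R" "B \<subseteq> A" for B
    proof -
      have B: "indicator B \<in> X" using that by (simp add: delta_ring_of_def)
      \<comment> \<open>Inside a null set for \<open>Z\<close>, \<open>indicator B\<close> is almost
        everywhere 0, so \<open>S\<close> kills it; as \<open>S\<close> extends \<open>T\<close>,
        also \<open>?m B = 0\<close>.\<close>
      have "ae_wrt M N' (\<lambda>x. indicator B x = (0::real))"
        unfolding ae_wrt_def using \<open>A \<in> N'\<close> that by (intro bexI[of _ A]) (auto simp: indicator_def)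
      then have "S (indicator B) = S (\<lambda>x. 0)"
        using Z(3) B ext(1) ideal_fs_zero[OF Z(1)]
        by (intro class_opD[of M N' Z S "indicator B" "\<lambda>x. 0"]) (auto simp: linear_op_def)
      moreover have "S (\<lambda>x. 0) = 0"
        using linear_op_scale[OF Z(3) ideal_fs_zero[OF Z(1)], of 0] by simp
      ultimately show ?thesis using ext(2) B by (simp add: vmeas_def)
    qed
    then show ?thesis using that N' by (auto simp: vm_null_iff)
  qed
  moreover have "f \<in> vm_L1 M ?R ?m" if f: "f \<in> Z" for f
    unfolding vm_L1_def
  proof (intro CollectI conjI allI ballI impI)
    show "f \<in> borel_measurable M" using Z(1) f by (rule ideal_fs_measurable)
    show "integrable (var_meas M ?R (xs \<circ> ?m)) f" if "bounded_linear xs" for xs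
      using represented_functional.integrable_var[OF rep[OF that] f] .
    show "\<exists>v. \<forall>xs. bounded_linear xs \<longrightarrow> xs v = sint M ?R (xs \<circ> ?m) A f" if "A \<in> sets M" for A
    \<comment> \<open>The witness for the integral over \<open>A\<close> is \<open>S\<close> at
      \<open>f\<close> cut off to \<open>A\<close>; it does not depend on the functional.\<close>
    proof (intro exI allI impI)
      fix xs :: "'e \<Rightarrow> real" assume "bounded_linear xs"
      then show "xs (S (\<lambda>x. f x * indicator A x)) = sint M ?R (xs \<circ> ?m) A f"
        by (rule represented_functional.sint_eq[OF rep f that, symmetric])
    qed
  qed
  ultimately show "incl_wd N' Z (vm_null M ?R ?m) (vm_L1 M ?R ?m)"
    by (auto simp: incl_wd_def)
  show "S f = vm_I M ?R ?m f" if f: "f \<in> Z"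
    by (rule vm_I_eqI[symmetric]) (rule represented_functional.sint_space[OF rep f, symmetric])
qed

text \<open>After applying a functional both claims concern integrals over its two variations:
  almost everywhere equal functions have equal integrals, and the increasing sequence is dominated
  by its integrable limit \<open>f\<close>.\<close>

lemma vm_I_properties:
  fixes m :: "'a set \<Rightarrow> 'e::real_normed_vector"
  assumes m: "\<And>xs :: 'e \<Rightarrow> real. bounded_linear xs \<Longrightarrow> charge M R (xs \<circ> m)"
  shows "class_op M (vm_null M R m) (vm_L1 M R m) (vm_I M R m)"
    and "order_w_cont M (vm_null M R m) (vm_L1 M R m) (vm_I M R m)"
proof -
  note AE = AE_of_ae_wrt_vm_null[OF m]
  have L1: "f \<in> borel_measurable M" "integrable (posv_meas M R (xs \<circ> m)) f"
      "integrable (negv_meas M R (xs \<circ> m)) f"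
    if "f \<in> vm_L1 M R m" "bounded_linear xs" for f and xs :: "'e \<Rightarrow> real"
  proof -
    have "\<forall>xs :: 'e \<Rightarrow> real. bounded_linear xs \<longrightarrow> integrable (var_meas M R (xs \<circ> m)) f"
      using that(1) unfolding vm_L1_def mem_Collect_eq by (elim conjE)
    moreover have "f \<in> borel_measurable M"
      using that(1) unfolding vm_L1_def mem_Collect_eq by (elim conjE)
    ultimately show "f \<in> borel_measurable M" "integrable (posv_meas M R (xs \<circ> m)) f"
        "integrable (negv_meas M R (xs \<circ> m)) f"
      using charge.integrable_posv_negv[OF m[OF that(2)], of f] that(2) by simp_all
  qed
  have sint: "sint M R (xs \<circ> m) (space M) f
    = integral\<^sup>L (posv_meas M R (xs \<circ> m)) f - integral\<^sup>L (negv_meas M R (xs \<circ> m)) f"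
    for f and xs :: "'e \<Rightarrow> real"
    unfolding sint_def by (intro arg_cong2[where f="(-)"] Bochner_Integration.integral_cong) auto
  show "class_op M (vm_null M R m) (vm_L1 M R m) (vm_I M R m)"
    unfolding class_op_def
  proof (intro ballI impI, rule functionals_separate)
    fix f g and xs :: "'e \<Rightarrow> real"
    assume fg: "f \<in> vm_L1 M R m" "g \<in> vm_L1 M R m" "ae_wrt M (vm_null M R m) (\<lambda>x. f x = g x)"
      and xs: "bounded_linear xs"
    have "integral\<^sup>L L f = integral\<^sup>L L g" if "AE x in L. f x = g x" "sets L = sets M" for L
      using L1(1)[OF fg(1) xs] L1(1)[OF fg(2) xs] that
      by (intro integral_cong_AE) (simp_all add: measurable_cong_sets[OF that(2) refl])
    then show "xs (vm_I M R m f) = xs (vm_I M R m g)"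
      unfolding vm_I_sint[OF fg(1) xs] vm_I_sint[OF fg(2) xs] sint
      using AE[OF xs xs fg(3)] by simp
  qed
  show "order_w_cont M (vm_null M R m) (vm_L1 M R m) (vm_I M R m)"
    unfolding order_w_cont_def
  proof (intro allI impI, elim conjE)
    fix fs :: "nat \<Rightarrow> 'a \<Rightarrow> real" and f and xs :: "'e \<Rightarrow> real"
    assume fs: "\<forall>n. fs n \<in> vm_L1 M R m" and f: "f \<in> vm_L1 M R m"
      and ae: "ae_wrt M (vm_null M R m) (\<lambda>x. \<forall>n. 0 \<le> fs n x \<and> fs n x \<le> fs (Suc n) x \<and> (\<lambda>n. fs n x) \<longlonglongrightarrow> f x)"
      and xs: "bounded_linear xs"
    have lim: "(\<lambda>n. integral\<^sup>L L (fs n)) \<longlonglongrightarrow> integral\<^sup>L L f"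
      if L: "sets L = sets M" "integrable L f"
        and ae: "AE x in L. \<forall>n. 0 \<le> fs n x \<and> fs n x \<le> fs (Suc n) x \<and> (\<lambda>n. fs n x) \<longlonglongrightarrow> f x" for L
    proof (rule integral_dominated_convergence)
      show "f \<in> borel_measurable L" "fs n \<in> borel_measurable L" for n
        using L1(1)[OF f xs] L1(1)[OF fs[rule_format] xs] by (simp_all add: measurable_cong_sets[OF L(1) refl])
      show "integrable L f" by (rule L)
      show "AE x in L. (\<lambda>n. fs n x) \<longlonglongrightarrow> f x" using ae by eventually_elim auto
      show "AE x in L. norm (fs n x) \<le> f x" for n
        using ae
      proof eventually_elim
        case (elim x)
        then have "incseq (\<lambda>n. fs n x)" "(\<lambda>n. fs n x) \<longlonglongrightarrow> f x"
          by (auto intro: incseq_SucI)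
        then have "fs n x \<le> f x" by (rule incseq_le)
        then show ?case using elim by simp
      qed
    qed
    show "(\<lambda>n. xs (vm_I M R m (fs n))) \<longlonglongrightarrow> xs (vm_I M R m f)"
      unfolding vm_I_sint[OF f xs] vm_I_sint[OF fs[rule_format] xs] sint
      by (intro tendsto_diff lim L1(2,3)[OF f xs] AE[OF xs xs ae]) simp_all
  qed
qed

theorem theorem3p2:
  fixes M :: "'a measure" and X :: "('a \<Rightarrow> real) set" and T :: "('a \<Rightarrow> real) \<Rightarrow> 'e::banach"
  assumes "ideal_fs M (null_sets M) X"
    and "sigma_property M X"
    and "linear_op M (null_sets M) X T"
    and "order_w_cont M (null_sets M) X T"
  shows "incl_wd (null_sets M) X (vm_null M (delta_ring_of M X) (vmeas T)) (vm_L1 M (delta_ring_of M X) (vmeas T))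
    \<and> (\<forall>f\<in>X. T f = vm_I M (delta_ring_of M X) (vmeas T) f)
    \<and> class_op M (vm_null M (delta_ring_of M X) (vmeas T)) (vm_L1 M (delta_ring_of M X) (vmeas T))
               (vm_I M (delta_ring_of M X) (vmeas T))
    \<and> order_w_cont M (vm_null M (delta_ring_of M X) (vmeas T)) (vm_L1 M (delta_ring_of M X) (vmeas T))
               (vm_I M (delta_ring_of M X) (vmeas T))
    \<and> (\<forall>(Xi :: 'a measure) (Z :: ('a \<Rightarrow> real) set) (S :: ('a \<Rightarrow> real) \<Rightarrow> 'e).
         sets Xi = sets M \<and> absolutely_continuous M Xi
         \<and> ideal_fs M (null_sets Xi) Z
         \<and> incl_wd (null_sets M) X (null_sets Xi) Z
         \<and> linear_op M (null_sets Xi) Z S \<and> order_w_cont M (null_sets Xi) Z S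
         \<and> (\<forall>f\<in>X. T f = S f)
       \<longrightarrow> incl_wd (null_sets Xi) Z (vm_null M (delta_ring_of M X) (vmeas T)) (vm_L1 M (delta_ring_of M X) (vmeas T))
         \<and> (\<forall>f\<in>Z. S f = vm_I M (delta_ring_of M X) (vmeas T) f))"
proof -
  have empty: "{} \<in> null_sets L" for L :: "'a measure" by simp
  have eq: "\<forall>f\<in>X. T f = T f" by simp
  note ext = factorization_of_extension[OF assms(1) empty assms(2-4)]
  \<comment> \<open>With \<open>Z = X\<close> and \<open>S = T\<close> the charge is a component of
    the representation locale.\<close>
  have charge: "charge M (delta_ring_of M X) (xs \<circ> vmeas T)" if "bounded_linear xs" for xs :: "'e \<Rightarrow> real"
    using represented_of_extension[OF assms(1) empty assms(2-4) assms(1) empty assms(3,4) order_refl eq that]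
    by (rule represented_functional.axioms(1))
  note self = ext[OF assms(1) empty assms(3,4) order_refl eq]
  show ?thesis
  proof (intro conjI allI impI ballI)
    show "incl_wd (null_sets M) X (vm_null M (delta_ring_of M X) (vmeas T)) (vm_L1 M (delta_ring_of M X) (vmeas T))"
      by (rule self(1)) auto
    show "T f = vm_I M (delta_ring_of M X) (vmeas T) f" if "f \<in> X" for f
      by (rule self(2)) (use that in auto)
  next
    fix Xi :: "'a measure" and Z and S :: "('a \<Rightarrow> real) \<Rightarrow> 'e"
    assume "sets Xi = sets M \<and> absolutely_continuous M Xi
         \<and> ideal_fs M (null_sets Xi) Z
         \<and> incl_wd (null_sets M) X (null_sets Xi) Z
         \<and> linear_op M (null_sets Xi) Z S \<and> order_w_cont M (null_sets Xi) Z S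
         \<and> (\<forall>f\<in>X. T f = S f)"
    then have Z: "ideal_fs M (null_sets Xi) Z" "linear_op M (null_sets Xi) Z S"
        "order_w_cont M (null_sets Xi) Z S" "X \<subseteq> Z" "\<forall>f\<in>X. T f = S f"
        "null_sets Xi \<subseteq> sets M"
      by (auto simp: incl_wd_def null_sets_def)
    note * = ext[OF Z(1) empty Z(2) Z(3) Z(4) Z(5) Z(6)]
    show "incl_wd (null_sets Xi) Z (vm_null M (delta_ring_of M X) (vmeas T)) (vm_L1 M (delta_ring_of M X) (vmeas T))"
      by (rule *(1))
    show "S f = vm_I M (delta_ring_of M X) (vmeas T) f" if "f \<in> Z" for f
      by (rule *(2)[OF that])
  \<comment> \<open>The goals left are class compatibility and order continuity of
    \<open>vm_I\<close>.\<close>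
  qed (rule vm_I_properties[OF charge]; assumption)+
qed

end
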